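(* Let $([\cdot,\cdot],\rho,\alpha)$ be a Loday algebroid structure on a vector bundle $E\to M$, and let $\partial$ be the associated coboundary operator. For all $X,Y\in\mathrm{Sec}(E)$, the graded derivations $\partial$, $i_X$, and $\mathcal L_X$ on $\mathcal D^\bullet(E)$ satisfy the following identities: (a) $2\partial^2=[\partial,\partial]_{\mathrm{sc}}=0$; (b) $\mathcal L_X=[\partial,i_X]_{\mathrm{sc}}=\partial i_X+i_X\partial$; (c) $\partial\mathcal L_X-\mathcal L_X\partial=[\partial,\mathcal L_X]_{\mathrm{sc}}=0$; (d) $\mathcal L_Xi_Y-i_Y\mathcal L_X=[\mathcal L_X,i_Y]_{\mathrm{sc}}=i_{[X,Y]}$; (e) $\mathcal L_X\mathcal L_Y-\mathcal L_Y\mathcal L_X=[\mathcal L_X,\mathcal L_Y]_{\mathrm{sc}}=\mathcal L_{[X,Y]}$.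
   Context: All objects are smooth. A Loday algebroid structure on $E$ is an $\mathbb R$-bilinear bracket on $\mathrm{Sec}(E)$ with $[X,[Y,Z]]=[[X,Y],Z]+[Y,[X,Z]]$, together with vector bundle morphisms over $\mathrm{id}_M$, $\rho:E\to TM$ and $\alpha:E\to TM\otimes_M\mathrm{End}(E)$, such that $[X,fY]=f[X,Y]+\rho(X)(f)Y$ and $[fX,Y]=f[X,Y]-\rho(Y)(f)X+\alpha(Y)(\mathrm df\otimes X)$. $\mathcal D^p(E)$ is the space of $p$-linear (over $\mathbb R$) multidifferential operators $\mathrm{Sec}(E)^p\to C^\infty(M)$, $\mathcal D^0(E)=C^\infty(M)$, $\mathcal D^\bullet(E)=\bigoplus_{p\ge0}\mathcal D^p(E)$, with the shuffle product $$(\ell'\pitchfork\ell'')(X_1,\ldots,X_{p+q})=\sum_{\sigma\in\mathrm{Sh}(p,q)}\mathrm{sign}(\sigma)\,\ell'(X_{\sigma_1},\ldots,X_{\sigma_p})\,\ell''(X_{\sigma_{p+1}},\ldots,X_{\sigma_{p+q}}).$$ The coboundary operator $\partial:\mathcal D^p(E)\to\mathcal D^{p+1}(E)$ is $$(\partial c)(X_1,\ldots,X_{p+1})=\sum_{i=1}^{p+1}(-1)^{i+1}\rho(X_i)\,c(X_1,\ldots\hat\imath\ldots,X_{p+1})+\sum_{i<j}(-1)^ic(X_1,\ldots\hat\imath\ldots,\overset{(j)}{[X_i,X_j]},\ldots,X_{p+1}),$$ ($\hat\imath$: $X_i$ omitted; $(j)$: the bracket takes the place of $X_j$). The contraction is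 $(i_X\ell)(X_1,\ldots,X_{p-1})=\ell(X,X_1,\ldots,X_{p-1})$ (zero on $\mathcal D^0(E)$), of degree $-1$. The Lie derivative is $\mathcal L_X:=[\partial,i_X]_{\mathrm{sc}}$, of degree $0$; explicitly $(\mathcal L_X\ell)(X_1,\dots,X_p)=\rho(X)(\ell(X_1,\dots,X_p))-\sum_i\ell(X_1,\dots,[X,X_i],\dots,X_p)$. $[\cdot,\cdot]_{\mathrm{sc}}$ is the graded commutator (supercommutator). *)

theory Defs
  imports
    "HOL-Analysis.Analysis"
    "HOL-Library.Function_Algebras"
    "HOL-Combinatorics.Permutations"
begin

section \<open>Preliminaries\<close>

text \<open>
  Functions, sections, tangent vectors, endomorphisms and multilinear operators are all functions;
  they carry the pointwise vector space structure.
\<close>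

instantiation "fun" :: (type, real_vector) real_vector
begin

definition scaleR_fun :: "real \<Rightarrow> ('a \<Rightarrow> 'b) \<Rightarrow> 'a \<Rightarrow> 'b"
  where "scaleR_fun r f = (\<lambda>x. r *\<^sub>R f x)"

instance
  by standard (auto simp: scaleR_fun_def fun_eq_iff algebra_simps)

end

lemma scaleR_fun_apply [simp]: "(r *\<^sub>R f) x = r *\<^sub>R f x"
  by (simp add: scaleR_fun_def)

definition linear_between ::
    "'a::real_vector set \<Rightarrow> 'b::real_vector set \<Rightarrow> ('a \<Rightarrow> 'b) \<Rightarrow> bool" where
  "linear_between S T A \<longleftrightarrow>
     (\<forall>v\<in>S. A v \<in> T) \<and>
     (\<forall>v\<in>S. \<forall>w\<in>S. A (v + w) = A v + A w) \<and>
     (\<forall>r. \<forall>v\<in>S. A (r *\<^sub>R v) = r *\<^sub>R A v)"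

text \<open>Both notions below are only meant for open sets.\<close>

primrec ck_on :: "nat \<Rightarrow> 'a::real_normed_vector set \<Rightarrow> ('a \<Rightarrow> 'b::real_normed_vector) \<Rightarrow> bool" where
  "ck_on 0 S f \<longleftrightarrow> continuous_on S f"
| "ck_on (Suc n) S f \<longleftrightarrow>
     (\<forall>x\<in>S. f differentiable (at x)) \<and>
     (\<forall>v. ck_on n S (\<lambda>x. frechet_derivative f (at x) v))"

definition smooth_on :: "'a::real_normed_vector set \<Rightarrow> ('a \<Rightarrow> 'b::real_normed_vector) \<Rightarrow> bool" where
  "smooth_on S f \<longleftrightarrow> (\<forall>n. ck_on n S f)"


section \<open>Smooth manifolds\<close>

text \<open>
  The underlying set of the manifold is the whole type, its topology comes from the type class.
  The model space is a real inner product space with a finite orthonormal basis.  The conditions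
  on the basis are the axioms of class \<^class>\<open>euclidean_space\<close> except that the basis may be
  empty: this way manifolds of dimension 0 (in particular a point) are included.
\<close>

record ('m, 'e) manifold =
  model_basis :: "'e set"
  charts :: "('m set \<times> ('m \<Rightarrow> 'e)) set"

definition smooth_manifold ::
    "('m::{t2_space,second_countable_topology}, 'e::real_inner) manifold \<Rightarrow> bool" where
  "smooth_manifold M \<longleftrightarrow>
     finite (model_basis M) \<and>
     (\<forall>u\<in>model_basis M. \<forall>v\<in>model_basis M. u \<bullet> v = (if u = v then 1 else 0)) \<and>
     (\<forall>x. (\<forall>u\<in>model_basis M. x \<bullet> u = 0) \<longleftrightarrow> x = 0) \<and>
     (\<forall>(U, \<phi>)\<in>charts M. open U \<and> open (\<phi> ` U) \<and> homeomorphism U (\<phi> ` U) \<phi> (inv_into U \<phi>)) \<and>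
     (\<Union>(U, \<phi>)\<in>charts M. U) = UNIV \<and>
     (\<forall>(U, \<phi>)\<in>charts M. \<forall>(V, \<psi>)\<in>charts M. smooth_on (\<phi> ` (U \<inter> V)) (\<psi> \<circ> inv_into U \<phi>))"

definition smooth_fun_on ::
    "('m::topological_space, 'e::real_inner) manifold \<Rightarrow> 'm set \<Rightarrow> ('m \<Rightarrow> real) \<Rightarrow> bool" where
  "smooth_fun_on M W f \<longleftrightarrow>
     (\<forall>(U, \<phi>)\<in>charts M. smooth_on (\<phi> ` (U \<inter> W)) (f \<circ> inv_into U \<phi>))"

definition smooth_funs ::
    "('m::topological_space, 'e::real_inner) manifold \<Rightarrow> ('m \<Rightarrow> real) set" where
  "smooth_funs M = {f. smooth_fun_on M UNIV f}"


section \<open>Vector bundles\<close>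

text \<open>
  The fibres are linear subspaces of an ambient vector space; they need not be disjoint, so a
  section is a function into the ambient space.  A local trivialisation is given as a local frame
  indexed by a finite set, whose cardinality is the rank.
\<close>

record ('m, 'k, 'v) vbundle =
  frame_index :: "'k set"
  fibre :: "'m \<Rightarrow> 'v set"
  frames :: "('m set \<times> ('k \<Rightarrow> 'm \<Rightarrow> 'v)) set"

definition smooth_section_on ::
    "('m::topological_space, 'e::real_inner) manifold \<Rightarrow> ('m, 'k, 'v::real_vector) vbundle \<Rightarrow>
     'm set \<Rightarrow> ('m \<Rightarrow> 'v) \<Rightarrow> bool" where
  "smooth_section_on M F W s \<longleftrightarrow>
     (\<forall>x\<in>W. s x \<in> fibre F x) \<and>
     (\<forall>(U, e)\<in>frames F. \<exists>h. (\<forall>k\<in>frame_index F. smooth_fun_on M (U \<inter> W) (h k)) \<and>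
        (\<forall>x\<in>U \<inter> W. s x = (\<Sum>k\<in>frame_index F. h k x *\<^sub>R e k x)))"

definition sections ::
    "('m::topological_space, 'e::real_inner) manifold \<Rightarrow> ('m, 'k, 'v::real_vector) vbundle \<Rightarrow>
     ('m \<Rightarrow> 'v) set" where
  "sections M F = {s. smooth_section_on M F UNIV s}"

text \<open>The last clause says that the transition functions between frames are smooth.\<close>

definition vector_bundle ::
    "('m::topological_space, 'e::real_inner) manifold \<Rightarrow> ('m, 'k, 'v::real_vector) vbundle \<Rightarrow> bool" where
  "vector_bundle M F \<longleftrightarrow>
     finite (frame_index F) \<and>
     (\<Union>(U, e)\<in>frames F. U) = UNIV \<and>
     (\<forall>(U, e)\<in>frames F. open U \<and>
        (\<forall>x\<in>U. inj_on (\<lambda>k. e k x) (frame_index F) \<and>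
               independent ((\<lambda>k. e k x) ` frame_index F) \<and>
               span ((\<lambda>k. e k x) ` frame_index F) = fibre F x)) \<and>
     (\<forall>(U, e)\<in>frames F. \<forall>k\<in>frame_index F. smooth_section_on M F U (e k))"

text \<open>Morphisms over the identity; smoothness means smooth matrix entries with respect to frames.\<close>

definition bundle_morphism ::
    "('m::topological_space, 'e::real_inner) manifold \<Rightarrow> ('m, 'k, 'v::real_vector) vbundle \<Rightarrow>
     ('m, 'l, 'w::real_vector) vbundle \<Rightarrow> ('m \<Rightarrow> 'v \<Rightarrow> 'w) \<Rightarrow> bool" where
  "bundle_morphism M F G \<Phi> \<longleftrightarrow>
     (\<forall>x. linear_between (fibre F x) (fibre G x) (\<Phi> x)) \<and>
     (\<forall>(U, e)\<in>frames F. \<forall>k\<in>frame_index F. smooth_section_on M G U (\<lambda>x. \<Phi> x (e k x)))"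

definition fmul :: "('m \<Rightarrow> real) \<Rightarrow> ('m \<Rightarrow> 'v::real_vector) \<Rightarrow> 'm \<Rightarrow> 'v" (infixr \<open>\<odot>\<close> 75) where
  "f \<odot> X = (\<lambda>x. f x *\<^sub>R X x)"


section \<open>The bundles \<open>TM\<close> and \<open>TM \<otimes> End(E)\<close>\<close>

text \<open>
  Tangent vectors at a point are the point derivations of the algebra of smooth functions.
  Operators on a set of functions or vectors are normalised to vanish off that set, so that equality
  of operators is equality of functions.
\<close>

type_synonym 'm tvec = "('m \<Rightarrow> real) \<Rightarrow> real"
type_synonym 'm covec = "'m tvec \<Rightarrow> real"

definition tangent_space ::
    "('m::topological_space, 'e::real_inner) manifold \<Rightarrow> 'm \<Rightarrow> 'm tvec set" where
  "tangent_space M x = {v.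
     linear_between (smooth_funs M) UNIV v \<and>
     (\<forall>f\<in>smooth_funs M. \<forall>g\<in>smooth_funs M. v (f * g) = v f * g x + f x * v g) \<and>
     (\<forall>f. f \<notin> smooth_funs M \<longrightarrow> v f = 0)}"

definition coord_field ::
    "('m::topological_space, 'e::real_inner) manifold \<Rightarrow> 'm set \<Rightarrow> ('m \<Rightarrow> 'e) \<Rightarrow> 'e \<Rightarrow> 'm \<Rightarrow> 'm tvec" where
  "coord_field M U \<phi> b x = (\<lambda>f. if f \<in> smooth_funs M
     then frechet_derivative (f \<circ> inv_into U \<phi>) (at (\<phi> x)) b else 0)"

definition tangent_bundle ::
    "('m::topological_space, 'e::real_inner) manifold \<Rightarrow> ('m, 'e, 'm tvec) vbundle" where
  "tangent_bundle M =
     \<lparr>frame_index = model_basis M,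
      fibre = tangent_space M,
      frames = (\<lambda>(U, \<phi>). (U, coord_field M U \<phi>)) ` charts M\<rparr>"

definition cotangent_space ::
    "('m::topological_space, 'e::real_inner) manifold \<Rightarrow> 'm \<Rightarrow> 'm covec set" where
  "cotangent_space M x = {\<xi>.
     linear_between (tangent_space M x) UNIV \<xi> \<and> (\<forall>v. v \<notin> tangent_space M x \<longrightarrow> \<xi> v = 0)}"

definition differential ::
    "('m::topological_space, 'e::real_inner) manifold \<Rightarrow> ('m \<Rightarrow> real) \<Rightarrow> 'm \<Rightarrow> 'm covec" where
  "differential M f x = (\<lambda>v. if v \<in> tangent_space M x then v f else 0)"

definition endo :: "('m, 'k, 'v::real_vector) vbundle \<Rightarrow> 'm \<Rightarrow> ('v \<Rightarrow> 'v) set" where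
  "endo E x = {A. linear_between (fibre E x) (fibre E x) A \<and> (\<forall>w. w \<notin> fibre E x \<longrightarrow> A w = 0)}"

text \<open>
  An element of \<open>T\<^sub>xM \<otimes> End(E\<^sub>x)\<close> is represented by the bilinear map through which it acts on
  \<open>T\<^sub>x\<^sup>*M \<otimes> E\<^sub>x\<close>; the pure tensor \<open>v \<otimes> A\<close> sends \<open>\<xi> \<otimes> w\<close> to \<open>\<xi>(v) A(w)\<close>.
\<close>

definition tensor_end ::
    "('m::topological_space, 'e::real_inner) manifold \<Rightarrow> ('m, 'k, 'v::real_vector) vbundle \<Rightarrow>
     'm \<Rightarrow> 'm tvec \<Rightarrow> ('v \<Rightarrow> 'v) \<Rightarrow> 'm covec \<Rightarrow> 'v \<Rightarrow> 'v" where
  "tensor_end M E x v A = (\<lambda>\<xi> w.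
     if \<xi> \<in> cotangent_space M x \<and> w \<in> fibre E x then \<xi> v *\<^sub>R A w else 0)"

text \<open>Elementary endomorphism of the fibre sending \<open>e\<^sub>l\<close> to \<open>e\<^sub>k\<close> and the other frame vectors to 0
  (\<^const>\<open>representation\<close> is 0 outside the span of the basis).\<close>

definition elem_endo :: "('m, 'k, 'v::real_vector) vbundle \<Rightarrow> ('k \<Rightarrow> 'm \<Rightarrow> 'v) \<Rightarrow> 'k \<Rightarrow> 'k \<Rightarrow> 'm \<Rightarrow> 'v \<Rightarrow> 'v" where
  "elem_endo E e k l x = (\<lambda>w. representation ((\<lambda>j. e j x) ` frame_index E) w (e l x) *\<^sub>R e k x)"

definition tangent_end_bundle ::
    "('m::topological_space, 'e::real_inner) manifold \<Rightarrow> ('m, 'k, 'v::real_vector) vbundle \<Rightarrow>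
     ('m, 'e \<times> 'k \<times> 'k, 'm covec \<Rightarrow> 'v \<Rightarrow> 'v) vbundle" where
  "tangent_end_bundle M E =
     \<lparr>frame_index = model_basis M \<times> frame_index E \<times> frame_index E,
      fibre = (\<lambda>x. span {tensor_end M E x v A | v A. v \<in> tangent_space M x \<and> A \<in> endo E x}),
      frames = {(U \<inter> V, \<lambda>(b, k, l) x. tensor_end M E x (coord_field M U \<phi> b x) (elem_endo E e k l x))
                | U \<phi> V e. (U, \<phi>) \<in> charts M \<and> (V, e) \<in> frames E}\<rparr>"


section \<open>Loday algebroids\<close>

record ('m, 'v) loday_structure =
  bracket :: "('m \<Rightarrow> 'v) \<Rightarrow> ('m \<Rightarrow> 'v) \<Rightarrow> 'm \<Rightarrow> 'v"
  anchor :: "'m \<Rightarrow> 'v \<Rightarrow> 'm tvec"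
  left_anchor :: "'m \<Rightarrow> 'v \<Rightarrow> 'm covec \<Rightarrow> 'v \<Rightarrow> 'v"

definition anchor_act :: "('m, 'v) loday_structure \<Rightarrow> ('m \<Rightarrow> 'v) \<Rightarrow> ('m \<Rightarrow> real) \<Rightarrow> 'm \<Rightarrow> real" where
  "anchor_act L X f = (\<lambda>x. anchor L x (X x) f)"

text \<open>\<open>\<alpha>(Y)(df \<otimes> X)\<close>\<close>

definition left_anchor_act ::
    "('m::topological_space, 'e::real_inner) manifold \<Rightarrow> ('m, 'v) loday_structure \<Rightarrow>
     ('m \<Rightarrow> 'v) \<Rightarrow> ('m \<Rightarrow> real) \<Rightarrow> ('m \<Rightarrow> 'v) \<Rightarrow> 'm \<Rightarrow> 'v" where
  "left_anchor_act M L Y f X = (\<lambda>x. left_anchor L x (Y x) (differential M f x) (X x))"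

definition loday_algebroid ::
    "('m::topological_space, 'e::real_inner) manifold \<Rightarrow> ('m, 'k, 'v::real_vector) vbundle \<Rightarrow>
     ('m, 'v) loday_structure \<Rightarrow> bool" where
  "loday_algebroid M E L \<longleftrightarrow>
     (\<forall>X\<in>sections M E. linear_between (sections M E) (sections M E) (\<lambda>Y. bracket L X Y)) \<and>
     (\<forall>Y\<in>sections M E. linear_between (sections M E) (sections M E) (\<lambda>X. bracket L X Y)) \<and>
     (\<forall>X\<in>sections M E. \<forall>Y\<in>sections M E. \<forall>Z\<in>sections M E.
        bracket L X (bracket L Y Z) = bracket L (bracket L X Y) Z + bracket L Y (bracket L X Z)) \<and>
     bundle_morphism M E (tangent_bundle M) (anchor L) \<and>
     bundle_morphism M E (tangent_end_bundle M E) (left_anchor L) \<and>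
     (\<forall>X\<in>sections M E. \<forall>Y\<in>sections M E. \<forall>f\<in>smooth_funs M.
        bracket L X (f \<odot> Y) = f \<odot> bracket L X Y + anchor_act L X f \<odot> Y \<and>
        bracket L (f \<odot> X) Y =
          f \<odot> bracket L X Y - anchor_act L Y f \<odot> X + left_anchor_act M L Y f X)"


section \<open>Multidifferential operators\<close>

text \<open>
  A \<open>p\<close>-linear operator is a function on lists of sections, set to 0 on all lists other than the lists
  of \<open>p\<close> sections.  Differential operators are taken in the algebraic sense: an operator has order at
  most \<open>k\<close> in its \<open>i\<close>-th argument iff all \<open>(k+1)\<close>-fold iterated commutators with multiplications by
  functions in that argument vanish.
\<close>

type_synonym ('m, 'v) oper = "('m \<Rightarrow> 'v) list \<Rightarrow> 'm \<Rightarrow> real"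

definition slot_comm :: "nat \<Rightarrow> ('m \<Rightarrow> real) \<Rightarrow> ('m, 'v::real_vector) oper \<Rightarrow> ('m, 'v) oper" where
  "slot_comm i f c = (\<lambda>Xs. c (Xs[i := f \<odot> (Xs ! i)]) - f * c Xs)"

definition diff_ops ::
    "('m::topological_space, 'e::real_inner) manifold \<Rightarrow> ('m, 'k, 'v::real_vector) vbundle \<Rightarrow>
     nat \<Rightarrow> ('m, 'v) oper set" where
  "diff_ops M E p = {c.
     (\<forall>Xs. \<not> (length Xs = p \<and> set Xs \<subseteq> sections M E) \<longrightarrow> c Xs = 0) \<and>
     (\<forall>Xs. length Xs = p \<and> set Xs \<subseteq> sections M E \<longrightarrow> c Xs \<in> smooth_funs M) \<and>
     (\<forall>Xs. \<forall>i<p. length Xs = p \<and> set Xs \<subseteq> sections M E \<longrightarrow>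
        linear_between (sections M E) (smooth_funs M) (\<lambda>X. c (Xs[i := X]))) \<and>
     (\<exists>k. \<forall>i<p. \<forall>fs Xs.
        length fs = Suc k \<and> set fs \<subseteq> smooth_funs M \<and> length Xs = p \<and> set Xs \<subseteq> sections M E \<longrightarrow>
        foldr (slot_comm i) fs c Xs = 0)}"

text \<open>
  Operators of different arity live on lists of different length, so the direct sum of the
  \<open>\<D>\<^sup>p(E)\<close> is the linear span of their union: the component of degree \<open>p\<close> of an element is its
  restriction to the lists of length \<open>p\<close>.
\<close>

definition all_diff_ops ::
    "('m::topological_space, 'e::real_inner) manifold \<Rightarrow> ('m, 'k, 'v::real_vector) vbundle \<Rightarrow>
     ('m, 'v) oper set" where
  "all_diff_ops M E = span (\<Union>p. diff_ops M E p)"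

definition shuffle_perms :: "nat \<Rightarrow> nat \<Rightarrow> (nat \<Rightarrow> nat) set" where
  "shuffle_perms p q = {\<sigma>. \<sigma> permutes {..<p + q} \<and>
     strict_mono_on {..<p} \<sigma> \<and> strict_mono_on {p..<p + q} \<sigma>}"

text \<open>The bilinear extension of the shuffle product to elements of mixed degree.\<close>

definition shuffle_prod :: "('m, 'v) oper \<Rightarrow> ('m, 'v) oper \<Rightarrow> ('m, 'v) oper" where
  "shuffle_prod c d = (\<lambda>Xs. \<Sum>p\<le>length Xs. \<Sum>\<sigma>\<in>shuffle_perms p (length Xs - p).
     real_of_int (sign \<sigma>) *\<^sub>R
       (c (map (\<lambda>i. Xs ! \<sigma> i) [0..<p]) * d (map (\<lambda>i. Xs ! \<sigma> i) [p..<length Xs])))"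


section \<open>Coboundary operator, contraction, Lie derivative\<close>

definition omit :: "nat \<Rightarrow> 'a list \<Rightarrow> 'a list" where
  "omit i Xs = take i Xs @ drop (Suc i) Xs"

text \<open>Positions in a list start at 0, hence the shift of the exponents of \<open>-1\<close> by one.\<close>

definition coboundary ::
    "('m::topological_space, 'e::real_inner) manifold \<Rightarrow> ('m, 'k, 'v::real_vector) vbundle \<Rightarrow>
     ('m, 'v) loday_structure \<Rightarrow> ('m, 'v) oper \<Rightarrow> ('m, 'v) oper" where
  "coboundary M E L c = (\<lambda>Xs. if set Xs \<subseteq> sections M E then
       (\<Sum>i<length Xs. (-1 :: real) ^ i *\<^sub>R anchor_act L (Xs ! i) (c (omit i Xs))) +
       (\<Sum>j<length Xs. \<Sum>i<j.
          (-1 :: real) ^ Suc i *\<^sub>R c (omit i (Xs[j := bracket L (Xs ! i) (Xs ! j)])))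
     else 0)"

definition contraction :: "('m \<Rightarrow> 'v) \<Rightarrow> ('m, 'v) oper \<Rightarrow> ('m, 'v) oper" where
  "contraction X c = (\<lambda>Xs. c (X # Xs))"

text \<open>Graded commutator of operators \<open>A\<close> and \<open>B\<close> of degrees \<open>a\<close> and \<open>b\<close>.\<close>

definition supercomm ::
    "int \<Rightarrow> ('a \<Rightarrow> 'a) \<Rightarrow> int \<Rightarrow> ('a \<Rightarrow> 'a) \<Rightarrow> 'a::real_vector \<Rightarrow> 'a" where
  "supercomm a A b B = (\<lambda>c. A (B c) - ((-1 :: real) powi (a * b)) *\<^sub>R B (A c))"

definition lie_derivative ::
    "('m::topological_space, 'e::real_inner) manifold \<Rightarrow> ('m, 'k, 'v::real_vector) vbundle \<Rightarrow>
     ('m, 'v) loday_structure \<Rightarrow> ('m \<Rightarrow> 'v) \<Rightarrow> ('m, 'v) oper \<Rightarrow> ('m, 'v) oper" where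
  "lie_derivative M E L X = supercomm 1 (coboundary M E L) (-1) (contraction X)"

text \<open>Graded derivation of degree \<open>a\<close> of the shuffle algebra; there is nothing in negative degrees.\<close>

definition graded_derivation ::
    "('m::topological_space, 'e::real_inner) manifold \<Rightarrow> ('m, 'k, 'v::real_vector) vbundle \<Rightarrow>
     int \<Rightarrow> (('m, 'v) oper \<Rightarrow> ('m, 'v) oper) \<Rightarrow> bool" where
  "graded_derivation M E a A \<longleftrightarrow>
     linear_between (all_diff_ops M E) (all_diff_ops M E) A \<and>
     (\<forall>p. \<forall>c\<in>diff_ops M E p.
        if int p + a \<ge> 0 then A c \<in> diff_ops M E (nat (int p + a)) else A c = 0) \<and>
     (\<forall>p. \<forall>c\<in>diff_ops M E p. \<forall>d\<in>all_diff_ops M E.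
        A (shuffle_prod c d) =
          shuffle_prod (A c) d + ((-1 :: real) powi (a * int p)) *\<^sub>R shuffle_prod c (A d))"

end

theory Submission
  imports Defs
begin

text \<open>
  The proof is Cartan calculus by induction on the number of arguments.  An operator is determined
  by its value on the empty list and by its contractions \<open>i\<^sub>Z\<close>, and everything in sight has a simple
  commutation rule with \<open>i\<^sub>Z\<close>.  Separating the terms of \<open>\<partial>c\<close> that involve the first argument gives
  \<open>i\<^sub>X \<partial> = L\<^sub>X - \<partial> i\<^sub>X\<close> with the explicit Lie derivative (\<open>lie_apply\<close>), and from its formula
  \<open>[L\<^sub>X, i\<^sub>Y] = i\<^sub>[\<^sub>X\<^sub>,\<^sub>Y\<^sub>]\<close> is immediate.  Each remaining identity then reproduces itself, up to sign, under
  contraction: if \<open>D = [L\<^sub>X, L\<^sub>Y] - L\<^sub>[\<^sub>X\<^sub>,\<^sub>Y\<^sub>]\<close>, then \<open>i\<^sub>Z D = D i\<^sub>Z\<close> by the Jacobi identity; next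
  \<open>i\<^sub>Z [L\<^sub>X, \<partial>] = - [L\<^sub>X, \<partial>] i\<^sub>Z\<close> by the rule for \<open>[L\<^sub>X, L\<^sub>Z]\<close>; and \<open>i\<^sub>Z \<partial>\<^sup>2 = \<partial>\<^sup>2 i\<^sub>Z\<close> by the rule for
  \<open>[L\<^sub>Z, \<partial>]\<close>.  On the empty list only \<open>[L\<^sub>X, L\<^sub>Y] = L\<^sub>[\<^sub>X\<^sub>,\<^sub>Y\<^sub>]\<close> has content: there it says that the anchor is
  a homomorphism (\<open>act_bracket\<close>).

  The Leibniz rules follow the same pattern.  A shuffle of \<open>X, X\<^sub>1, \<dots>, X\<^sub>n\<close> hands \<open>X\<close> either to the left
  factor, as its first argument, or to the right one, past all arguments of the left factor; this is
  the statement that \<open>i\<^sub>X\<close> is a graded derivation (\<open>shuffle_prod_Cons\<close>), and it is the only place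
  where permutations are handled.  The rules for \<open>L\<^sub>X\<close> and then for \<open>\<partial>\<close> are inductions using the
  commutation rules above.

  It remains to see that \<open>\<partial>\<close> preserves multidifferential operators.  Values stay smooth because the
  anchor maps smooth sections to smooth vector fields.  In each argument, every term of \<open>\<partial>c\<close> is a
  composition of \<open>c\<close> with an operator of order at most one: the action of a section on functions,
  or the bracket with a fixed section.  That the bracket is of first order in its left
  argument is precisely the role of the map \<open>\<alpha>\<close>.
\<close>

section \<open>Calculus of smooth functions\<close>

lemma has_derivative_cong_open:
  assumes "open S" "x \<in> S" "\<And>y. y \<in> S \<Longrightarrow> f y = g y"
  shows "(f has_derivative D) (at x) \<longleftrightarrow> (g has_derivative D) (at x)"
  using has_derivative_transform_within_open[of f D x UNIV S g]
    has_derivative_transform_within_open[of g D x UNIV S f] assms by auto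

lemma ck_on_cong:
  assumes "open S" "\<And>y. y \<in> S \<Longrightarrow> f y = g y"
  shows "ck_on n S f \<longleftrightarrow> ck_on n S g"
  using assms(2)
proof (induction n arbitrary: f g)
  case 0
  then show ?case by (simp cong: continuous_on_cong)
next
  case (Suc n)
  have D: "(f has_derivative D) (at x) \<longleftrightarrow> (g has_derivative D) (at x)" if "x \<in> S" for x D
    using has_derivative_cong_open[OF assms(1) that Suc.prems] .
  then have "f differentiable (at x) \<longleftrightarrow> g differentiable (at x)" if "x \<in> S" for x
    using that by (simp add: differentiable_def)
  moreover have "ck_on n S (\<lambda>x. frechet_derivative f (at x) v) \<longleftrightarrow>
      ck_on n S (\<lambda>x. frechet_derivative g (at x) v)" for v
    using D by (intro Suc.IH) (simp add: frechet_derivative_def)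
  ultimately show ?case by simp
qed

lemma ck_on_subset: "ck_on n S f \<Longrightarrow> T \<subseteq> S \<Longrightarrow> ck_on n T f"
  by (induction n arbitrary: f) (auto intro: continuous_on_subset)

lemma ck_on_Suc_imp: "ck_on (Suc n) S f \<Longrightarrow> ck_on n S f"
proof (induction n arbitrary: f)
  case 0
  then show ?case
    by (auto intro!: continuous_at_imp_continuous_on differentiable_imp_continuous_within)
next
  case (Suc n)
  have "\<forall>x\<in>S. f differentiable (at x)"
    and "\<And>v. ck_on (Suc n) S (\<lambda>x. frechet_derivative f (at x) v)"
    using Suc.prems[unfolded ck_on.simps(2)[of "Suc n"]] by blast+
  then show ?case
    using Suc.IH by (simp only: ck_on.simps(2)[of n] simp_thms) blast
qed

lemma ck_on_const: "ck_on n S (\<lambda>x. c)"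
  by (induction n arbitrary: c) (auto simp: frechet_derivative_const)

lemma ck_on_add:
  assumes "open S" "ck_on n S f" "ck_on n S g"
  shows "ck_on n S (\<lambda>x. f x + g x)"
  using assms(2,3)
proof (induction n arbitrary: f g)
  case 0
  then show ?case by (auto intro: continuous_on_add)
next
  case (Suc n)
  have "ck_on n S (\<lambda>x. frechet_derivative (\<lambda>x. f x + g x) (at x) v)" for v
  proof (subst ck_on_cong[OF assms(1)])
    show "frechet_derivative (\<lambda>x. f x + g x) (at x) v =
        frechet_derivative f (at x) v + frechet_derivative g (at x) v" if "x \<in> S" for x
    proof -
      have "((\<lambda>x. f x + g x) has_derivative
          (\<lambda>v. frechet_derivative f (at x) v + frechet_derivative g (at x) v)) (at x)"
        using Suc.prems that
        by (intro has_derivative_add) (simp_all add: frechet_derivative_works[symmetric])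
      then show ?thesis by (simp add: frechet_derivative_at[symmetric])
    qed
    show "ck_on n S (\<lambda>x. frechet_derivative f (at x) v + frechet_derivative g (at x) v)"
      using Suc by simp
  qed
  then show ?case using Suc.prems by (auto intro: differentiable_add)
qed

lemma ck_on_mult:
  fixes f g :: "'a::real_normed_vector \<Rightarrow> real"
  assumes "open S" "ck_on n S f" "ck_on n S g"
  shows "ck_on n S (\<lambda>x. f x * g x)"
  using assms(2,3)
proof (induction n arbitrary: f g)
  case 0
  then show ?case by (auto intro: continuous_on_mult)
next
  case (Suc n)
  have "ck_on n S (\<lambda>x. frechet_derivative (\<lambda>x. f x * g x) (at x) v)" for v
  proof (subst ck_on_cong[OF assms(1)])
    show "frechet_derivative (\<lambda>x. f x * g x) (at x) v =
        f x * frechet_derivative g (at x) v + frechet_derivative f (at x) v * g x" if "x \<in> S" for x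
    proof -
      have "((\<lambda>x. f x * g x) has_derivative
          (\<lambda>v. f x * frechet_derivative g (at x) v + frechet_derivative f (at x) v * g x)) (at x)"
        using Suc.prems that 
        by (intro has_derivative_mult) (simp_all add: frechet_derivative_works[symmetric])
      then show ?thesis by (simp add: frechet_derivative_at[symmetric])
    qed
    show "ck_on n S (\<lambda>x. f x * frechet_derivative g (at x) v + frechet_derivative f (at x) v * g x)"
      using Suc.prems ck_on_Suc_imp[OF Suc.prems(1)] ck_on_Suc_imp[OF Suc.prems(2)]
      by (intro ck_on_add[OF assms(1)] Suc.IH) simp_all
  qed
  then show ?case using Suc.prems by (auto intro: differentiable_mult)
qed

lemma ck_on_local:
  assumes "\<And>y. y \<in> S \<Longrightarrow> \<exists>T. open T \<and> y \<in> T \<and> ck_on n T f"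
  shows "ck_on n S f"
  using assms
proof (induction n arbitrary: f)
  case 0
  show ?case
  proof (simp, rule continuous_at_imp_continuous_on, rule ballI)
    fix y assume "y \<in> S"
    with 0 obtain T where "open T" "y \<in> T" "continuous_on T f" by force
    then show "isCont f y" by (simp add: continuous_on_eq_continuous_at)
  qed
next
  case (Suc n)
  show ?case
  proof (simp, intro conjI ballI allI)
    fix x assume "x \<in> S"
    with Suc.prems show "f differentiable at x" by fastforce
  next
    fix v
    show "ck_on n S (\<lambda>x. frechet_derivative f (at x) v)"
      by (rule Suc.IH) (use Suc.prems in fastforce)
  qed
qed

lemma smooth_on_subset: "smooth_on S f \<Longrightarrow> T \<subseteq> S \<Longrightarrow> smooth_on T f"
  by (auto simp: smooth_on_def intro: ck_on_subset)

lemma smooth_on_cong: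
  "open S \<Longrightarrow> (\<And>y. y \<in> S \<Longrightarrow> f y = g y) \<Longrightarrow> smooth_on S f \<Longrightarrow> smooth_on S g"
  using ck_on_cong[of S f g] by (auto simp: smooth_on_def)

lemma smooth_on_const: "smooth_on S (\<lambda>x. c)"
  by (simp add: smooth_on_def ck_on_const)

lemma smooth_on_add:
  "open S \<Longrightarrow> smooth_on S f \<Longrightarrow> smooth_on S g \<Longrightarrow> smooth_on S (\<lambda>x. f x + g x)"
  by (simp add: smooth_on_def ck_on_add)

lemma smooth_on_mult:
  fixes f g :: "'a::real_normed_vector \<Rightarrow> real"
  shows "open S \<Longrightarrow> smooth_on S f \<Longrightarrow> smooth_on S g \<Longrightarrow> smooth_on S (\<lambda>x. f x * g x)"
  by (simp add: smooth_on_def ck_on_mult)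

lemma smooth_on_sum:
  fixes f :: "'i \<Rightarrow> 'a::real_normed_vector \<Rightarrow> real"
  assumes "open S" "finite I" "\<And>i. i \<in> I \<Longrightarrow> smooth_on S (f i)"
  shows "smooth_on S (\<lambda>x. \<Sum>i\<in>I. f i x)"
  using assms(2,3)
  by (induction I rule: finite_induct) (auto intro: smooth_on_add assms(1) smooth_on_const)

lemma smooth_on_directional_derivative:
  "smooth_on S f \<Longrightarrow> smooth_on S (\<lambda>x. frechet_derivative f (at x) v)"
  unfolding smooth_on_def using ck_on.simps(2) by blast

lemma smooth_on_local:
  "(\<And>y. y \<in> S \<Longrightarrow> \<exists>T. open T \<and> y \<in> T \<and> smooth_on T f) \<Longrightarrow> smooth_on S f"
  unfolding smooth_on_def by (rule allI, rule ck_on_local) blast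

section \<open>Smooth functions and sections\<close>

lemma linear_between_sum:
  assumes "linear_between S T A" "subspace S" "finite I" "\<And>i. i \<in> I \<Longrightarrow> v i \<in> S"
  shows "A (\<Sum>i\<in>I. r i *\<^sub>R v i) = (\<Sum>i\<in>I. r i *\<^sub>R A (v i))"
  using assms(3,4)
proof (induction I rule: finite_induct)
  case empty
  have "A (0 *\<^sub>R 0) = 0 *\<^sub>R A 0"
    using assms(1,2) unfolding linear_between_def by (meson subspace_0)
  then show ?case by simp
next
  case (insert i I)
  have "(\<Sum>i\<in>I. r i *\<^sub>R v i) \<in> S"
    using insert.prems by (intro subspace_sum[OF assms(2)] subspace_scale[OF assms(2)]) auto
  moreover have "r i *\<^sub>R v i \<in> S"
    using insert.prems by (intro subspace_scale[OF assms(2)]) auto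
  ultimately show ?case
    using insert assms(1) by (auto simp: linear_between_def)
qed

lemma sum_scaleR_fun_apply:
  fixes V :: "'i \<Rightarrow> 'a \<Rightarrow> 'b::real_vector"
  shows "(\<Sum>i\<in>I. r i *\<^sub>R V i) x = (\<Sum>i\<in>I. r i *\<^sub>R V i x)"
  by (induction I rule: infinite_finite_induct) auto

lemma section_in_fibre: "X \<in> sections M E \<Longrightarrow> X x \<in> fibre E x"
  by (simp add: sections_def smooth_section_on_def)

context
  fixes M :: "('m::{t2_space,second_countable_topology}, 'e::real_inner) manifold"
  assumes M: "smooth_manifold M"
begin

lemma open_chart_image:
  assumes "(U, \<phi>) \<in> charts M" "open W"
  shows "open (\<phi> ` (U \<inter> W))"
proof -
  have U: "open U" "open (\<phi> ` U)" "homeomorphism U (\<phi> ` U) \<phi> (inv_into U \<phi>)"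
    using M assms(1) unfolding smooth_manifold_def by auto
  have "openin (top_of_set (\<phi> ` U)) (\<phi> ` (U \<inter> W))"
    using homeomorphism_imp_open_map[OF U(3)] assms(2) by (simp add: openin_open_Int)
  then show ?thesis using U(2) openin_open_trans by blast
qed

lemma smooth_fun_on_add:
  assumes "open W" "smooth_fun_on M W f" "smooth_fun_on M W g"
  shows "smooth_fun_on M W (f + g)"
  using assms smooth_on_add[OF open_chart_image]
  by (fastforce simp: smooth_fun_on_def comp_def plus_fun_def)

lemma smooth_fun_on_mult:
  assumes "open W" "smooth_fun_on M W f" "smooth_fun_on M W g"
  shows "smooth_fun_on M W (f * g)"
  using assms smooth_on_mult[OF open_chart_image]
  by (fastforce simp: smooth_fun_on_def comp_def times_fun_def)

lemma smooth_fun_on_const: "smooth_fun_on M W (\<lambda>x. r)"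
  by (auto simp: smooth_fun_on_def comp_def smooth_on_const)

lemma smooth_fun_on_subset: "smooth_fun_on M W f \<Longrightarrow> V \<subseteq> W \<Longrightarrow> smooth_fun_on M V f"
  by (fastforce simp: smooth_fun_on_def intro: smooth_on_subset)

lemma smooth_funs_mult: "f \<in> smooth_funs M \<Longrightarrow> g \<in> smooth_funs M \<Longrightarrow> f * g \<in> smooth_funs M"
  by (simp add: smooth_funs_def smooth_fun_on_mult)

lemma scaleR_eq_const_mult: "r *\<^sub>R f = (\<lambda>x. r) * (f :: 'm \<Rightarrow> real)"
  by (simp add: fun_eq_iff)

lemma subspace_smooth_funs: "subspace (smooth_funs M)"
  by (auto simp: subspace_def smooth_funs_def zero_fun_def scaleR_eq_const_mult
      intro!: smooth_fun_on_add smooth_fun_on_const smooth_fun_on_mult)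

context
  fixes E :: "('m, 'k, 'v::real_vector) vbundle"
  assumes E: "vector_bundle M E"
begin

lemma subspace_fibre: "subspace (fibre E x)"
proof -
  have "x \<in> (\<Union>(U, e)\<in>frames E. U)" using E by (simp add: vector_bundle_def)
  then obtain U e where "(U, e) \<in> frames E" "x \<in> U" by auto
  then have "span ((\<lambda>k. e k x) ` frame_index E) = fibre E x"
    using E by (fastforce simp: vector_bundle_def)
  then show ?thesis by (metis subspace_span)
qed

lemma sections_frameE:
  assumes "X \<in> sections M E" "(U, e) \<in> frames E"
  obtains h where "\<And>k. k \<in> frame_index E \<Longrightarrow> smooth_fun_on M U (h k)"
    "\<And>x. x \<in> U \<Longrightarrow> X x = (\<Sum>k\<in>frame_index E. h k x *\<^sub>R e k x)"
  using assms by (fastforce simp: sections_def smooth_section_on_def)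

lemma sectionsI:
  assumes "\<And>x. X x \<in> fibre E x"
    and "\<And>U e. (U, e) \<in> frames E \<Longrightarrow> \<exists>h. (\<forall>k\<in>frame_index E. smooth_fun_on M U (h k)) \<and>
        (\<forall>x\<in>U. X x = (\<Sum>k\<in>frame_index E. h k x *\<^sub>R e k x))"
  shows "X \<in> sections M E"
  using assms by (fastforce simp: sections_def smooth_section_on_def)

lemma open_frame: "(U, e) \<in> frames E \<Longrightarrow> open U"
  using E by (fastforce simp: vector_bundle_def)

lemma sections_add:
  assumes "X \<in> sections M E" "Y \<in> sections M E"
  shows "X + Y \<in> sections M E"
proof (rule sectionsI)
  show "(X + Y) x \<in> fibre E x" for x
    using assms section_in_fibre[of _ M E] subspace_add[OF subspace_fibre] by simp
next
  fix U e assume F: "(U, e) \<in> frames E"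
  obtain h where h: "\<And>k. k \<in> frame_index E \<Longrightarrow> smooth_fun_on M U (h k)"
    "\<And>x. x \<in> U \<Longrightarrow> X x = (\<Sum>k\<in>frame_index E. h k x *\<^sub>R e k x)"
    using sections_frameE[OF assms(1) F] by metis
  obtain g where g: "\<And>k. k \<in> frame_index E \<Longrightarrow> smooth_fun_on M U (g k)"
    "\<And>x. x \<in> U \<Longrightarrow> Y x = (\<Sum>k\<in>frame_index E. g k x *\<^sub>R e k x)"
    using sections_frameE[OF assms(2) F] by metis
  show "\<exists>h. (\<forall>k\<in>frame_index E. smooth_fun_on M U (h k)) \<and>
      (\<forall>x\<in>U. (X + Y) x = (\<Sum>k\<in>frame_index E. h k x *\<^sub>R e k x))"
    using smooth_fun_on_add[OF open_frame[OF F]] h g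
    by (intro exI[of _ "\<lambda>k. h k + g k"]) (simp add: scaleR_left_distrib sum.distrib)
qed

lemma sections_fmul:
  assumes "f \<in> smooth_funs M" "X \<in> sections M E"
  shows "f \<odot> X \<in> sections M E"
proof (rule sectionsI)
  show "(f \<odot> X) x \<in> fibre E x" for x
    using assms section_in_fibre[of _ M E] subspace_scale[OF subspace_fibre] by (simp add: fmul_def)
next
  fix U e assume F: "(U, e) \<in> frames E"
  obtain h where h: "\<And>k. k \<in> frame_index E \<Longrightarrow> smooth_fun_on M U (h k)"
    "\<And>x. x \<in> U \<Longrightarrow> X x = (\<Sum>k\<in>frame_index E. h k x *\<^sub>R e k x)"
    using sections_frameE[OF assms(2) F] by metis
  have "smooth_fun_on M U f"
    using assms(1) smooth_fun_on_subset unfolding smooth_funs_def by blast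
  then show "\<exists>h. (\<forall>k\<in>frame_index E. smooth_fun_on M U (h k)) \<and>
      (\<forall>x\<in>U. (f \<odot> X) x = (\<Sum>k\<in>frame_index E. h k x *\<^sub>R e k x))"
    using smooth_fun_on_mult[OF open_frame[OF F]] h
    by (intro exI[of _ "\<lambda>k. f * h k"]) (simp add: scaleR_sum_right fmul_def)
qed

lemma subspace_sections: "subspace (sections M E)"
  unfolding subspace_def
proof (intro conjI ballI allI)
  show "0 \<in> sections M E"
    by (rule sectionsI)
      (auto simp: subspace_0[OF subspace_fibre] smooth_fun_on_const intro!: exI[of _ "\<lambda>k x. 0"])
  fix X assume X: "X \<in> sections M E"
  show "r *\<^sub>R X \<in> sections M E" for r
    using sections_fmul[OF _ X, of "\<lambda>x. r"] smooth_fun_on_const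
    by (simp add: fmul_def smooth_funs_def scaleR_fun_def)
qed (rule sections_add)

text \<open>Over a chart domain, an anchored section is a combination with smooth coefficients of the
  coordinate fields of that same chart, and these act on functions as directional derivatives.\<close>

lemma smooth_anchor_act:
  assumes anchor: "bundle_morphism M E (tangent_bundle M) (anchor L)"
    and X: "X \<in> sections M E" and f: "f \<in> smooth_funs M"
  shows "anchor_act L X f \<in> smooth_funs M"
  unfolding smooth_funs_def smooth_fun_on_def
proof (clarsimp)
  fix U \<phi> assume ch: "(U, \<phi>) \<in> charts M"
  then have hom: "homeomorphism U (\<phi> ` U) \<phi> (inv_into U \<phi>)"
    using M unfolding smooth_manifold_def by auto
  let ?inv = "inv_into U \<phi>"
  let ?B = "model_basis M" and ?K = "frame_index E"
  have finB: "finite ?B" using M by (simp add: smooth_manifold_def)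
  have finK: "finite ?K" using E by (simp add: vector_bundle_def)
  show "smooth_on (\<phi> ` U) (anchor_act L X f \<circ> ?inv)"
  proof (rule smooth_on_local)
    fix y assume "y \<in> \<phi> ` U"
    then obtain x where x: "x \<in> U" "y = \<phi> x" by auto
    have "x \<in> (\<Union>(W, e)\<in>frames E. W)" using E by (simp add: vector_bundle_def)
    then obtain W e where F: "(W, e) \<in> frames E" and xW: "x \<in> W" by auto
    have W: "open W" using open_frame[OF F] .
    obtain h where h: "\<And>k. k \<in> ?K \<Longrightarrow> smooth_fun_on M W (h k)"
      "\<And>x. x \<in> W \<Longrightarrow> X x = (\<Sum>k\<in>?K. h k x *\<^sub>R e k x)"
      using sections_frameE[OF X F] by blast
    have "\<forall>k\<in>?K. \<exists>g. (\<forall>b\<in>?B. smooth_fun_on M (U \<inter> W) (g b)) \<and>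
        (\<forall>x\<in>U \<inter> W. anchor L x (e k x) = (\<Sum>b\<in>?B. g b x *\<^sub>R coord_field M U \<phi> b x))"
    proof
      fix k assume "k \<in> ?K"
      then have s: "smooth_section_on M (tangent_bundle M) W (\<lambda>x. anchor L x (e k x))"
        using anchor F by (fastforce simp: bundle_morphism_def)
      have "(U, coord_field M U \<phi>) \<in> frames (tangent_bundle M)"
        using ch by (force simp: tangent_bundle_def)
      with s have "\<exists>g. (\<forall>b\<in>frame_index (tangent_bundle M). smooth_fun_on M (U \<inter> W) (g b)) \<and>
        (\<forall>x\<in>U \<inter> W. anchor L x (e k x) =
          (\<Sum>b\<in>frame_index (tangent_bundle M). g b x *\<^sub>R coord_field M U \<phi> b x))"
        unfolding smooth_section_on_def by blast
      then show "\<exists>g. (\<forall>b\<in>?B. smooth_fun_on M (U \<inter> W) (g b)) \<and>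
        (\<forall>x\<in>U \<inter> W. anchor L x (e k x) = (\<Sum>b\<in>?B. g b x *\<^sub>R coord_field M U \<phi> b x))"
        by (simp add: tangent_bundle_def)
    qed
    from bchoice[OF this] obtain g where "\<forall>k\<in>?K. (\<forall>b\<in>?B. smooth_fun_on M (U \<inter> W) (g k b)) \<and>
        (\<forall>x\<in>U \<inter> W. anchor L x (e k x) = (\<Sum>b\<in>?B. g k b x *\<^sub>R coord_field M U \<phi> b x))" ..
    then have g: "\<And>k b. k \<in> ?K \<Longrightarrow> b \<in> ?B \<Longrightarrow> smooth_fun_on M (U \<inter> W) (g k b)"
      "\<And>k x. k \<in> ?K \<Longrightarrow> x \<in> U \<inter> W \<Longrightarrow>
         anchor L x (e k x) = (\<Sum>b\<in>?B. g k b x *\<^sub>R coord_field M U \<phi> b x)"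
      by blast+
    let ?T = "\<phi> ` (U \<inter> W)"
    have T: "open ?T" using open_chart_image[OF ch W] .
    have sh: "smooth_on ?T (h k \<circ> ?inv)" if "k \<in> ?K" for k
      using h(1)[OF that] ch by (auto simp: smooth_fun_on_def)
    have sg: "smooth_on ?T (g k b \<circ> ?inv)" if "k \<in> ?K" "b \<in> ?B" for k b
      using g(1)[OF that] ch by (fastforce simp: smooth_fun_on_def)
    have "smooth_on (\<phi> ` U) (f \<circ> ?inv)"
      using f ch by (auto simp: smooth_funs_def smooth_fun_on_def)
    then have sf: "smooth_on ?T (\<lambda>y. frechet_derivative (f \<circ> ?inv) (at y) b)" for b
      by (intro smooth_on_directional_derivative) (auto elim: smooth_on_subset)
    have "smooth_on ?T (\<lambda>y. \<Sum>k\<in>?K. (h k \<circ> ?inv) y *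
        (\<Sum>b\<in>?B. (g k b \<circ> ?inv) y * frechet_derivative (f \<circ> ?inv) (at y) b))"
      using sh sg sf finK finB
      by (intro smooth_on_sum smooth_on_mult T) (simp_all add: o_def)
    then have "smooth_on ?T (anchor_act L X f \<circ> ?inv)"
    proof (rule smooth_on_cong[OF T, rotated])
      fix y assume "y \<in> ?T"
      then obtain z where z: "z \<in> U" "z \<in> W" "y = \<phi> z" by auto
      have iz: "?inv y = z" using hom z by (simp add: homeomorphism_apply1)
      have ez: "e k z \<in> fibre E z" if "k \<in> ?K" for k
      proof -
        have "span ((\<lambda>k. e k z) ` ?K) = fibre E z"
          using E F z by (fastforce simp: vector_bundle_def)
        then show ?thesis using that by (metis imageI span_base)
      qed
      have "anchor L z (X z) = (\<Sum>k\<in>?K. h k z *\<^sub>R anchor L z (e k z))"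
        using anchor h(2)[OF z(2)] ez finK subspace_fibre
        by (auto simp: bundle_morphism_def intro!: linear_between_sum)
      then have "anchor L z (X z) f =
          (\<Sum>k\<in>?K. h k z *\<^sub>R (\<Sum>b\<in>?B. g k b z *\<^sub>R coord_field M U \<phi> b z f))"
        using g(2) z by (simp add: sum_scaleR_fun_apply)
      then show "(\<Sum>k\<in>?K. (h k \<circ> ?inv) y *
          (\<Sum>b\<in>?B. (g k b \<circ> ?inv) y * frechet_derivative (f \<circ> ?inv) (at y) b)) =
          (anchor_act L X f \<circ> ?inv) y"
        using f iz z(3) by (simp add: anchor_act_def coord_field_def)
    qed
    then show "\<exists>T. open T \<and> y \<in> T \<and> smooth_on T (anchor_act L X f \<circ> ?inv)"
      using T x xW by blast
  qed
qed

end

end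

section \<open>The shuffle product by recursion on the arguments\<close>

text \<open>Shuffles of \<open>{0..n}\<close> arise from shuffles \<open>\<sigma>\<close> of \<open>{0..<n}\<close>: fix 0 and let \<open>\<sigma>\<close> act on the rest, so
  that 0 becomes the first element of the left block; or precompose this with the cycle that moves
  position \<open>p\<close> to the front, so that 0 becomes the first element of the right block.  The cycle
  contributes the sign \<open>(-1)\<^sup>p\<close>.\<close>

definition shift_perm :: "(nat \<Rightarrow> nat) \<Rightarrow> nat \<Rightarrow> nat" where
  "shift_perm \<sigma> = case_nat 0 (\<lambda>i. Suc (\<sigma> i))"

lemma shift_perm_simps [simp]:
  "shift_perm \<sigma> 0 = 0" "shift_perm \<sigma> (Suc i) = Suc (\<sigma> i)"
  by (simp_all add: shift_perm_def)

lemma inj_shift_perm: "inj shift_perm"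
proof (rule injI, rule ext)
  fix \<sigma> \<tau> i assume "shift_perm \<sigma> = shift_perm \<tau>"
  then have "shift_perm \<sigma> (Suc i) = shift_perm \<tau> (Suc i)" by simp
  then show "\<sigma> i = \<tau> i" by simp
qed

lemma shift_perm_eq_map_permutation:
  assumes "\<sigma> permutes {..<n}"
  shows "shift_perm \<sigma> = map_permutation {..<n} Suc \<sigma>"
proof
  fix i
  show "shift_perm \<sigma> i = map_permutation {..<n} Suc \<sigma> i"
  proof (cases "i \<in> Suc ` {..<n}")
    case True
    then show ?thesis by (auto simp: map_permutation_apply)
  next
    case False
    then have "map_permutation {..<n} Suc \<sigma> i = i" by (simp add: map_permutation_def)
    moreover have "shift_perm \<sigma> i = i"
      using False permutes_not_in[OF assms] by (cases i) auto
    ultimately show ?thesis by simp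
  qed
qed

lemma shift_perm_permutes:
  assumes "\<sigma> permutes {..<n}"
  shows "shift_perm \<sigma> permutes {..<Suc n}"
proof -
  have "shift_perm \<sigma> permutes Suc ` {..<n}"
    unfolding shift_perm_eq_map_permutation[OF assms]
    by (rule map_permutation_permutes[OF _ assms]) (simp add: bij_betw_def)
  then show ?thesis by (rule permutes_subset) auto
qed

lemma sign_shift_perm: "\<sigma> permutes {..<n} \<Longrightarrow> sign (shift_perm \<sigma>) = sign \<sigma>"
  by (subst shift_perm_eq_map_permutation) (auto intro: sign_map_permutation)

lemma permutes_fixing_0E:
  assumes "\<tau> permutes {..<Suc n}" "\<tau> 0 = 0"
  obtains \<sigma> where "\<sigma> permutes {..<n}" "\<tau> = shift_perm \<sigma>"
proof -
  let ?A = "Suc ` {..<n}"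
  have tau: "\<tau> permutes ?A"
    by (rule permutes_superset[OF assms(1)])
      (use assms(2) in \<open>auto simp: lessThan_Suc_eq_insert_0\<close>)
  define \<sigma> where "\<sigma> = map_permutation ?A (\<lambda>i. i - 1) \<tau>"
  have inj: "inj_on (\<lambda>i. i - 1) ?A" by (rule inj_onI) auto
  have "\<sigma> permutes {..<n}"
    unfolding \<sigma>_def
    by (rule map_permutation_permutes[OF _ tau]) (rule bij_betw_imageI[OF inj], simp add: image_image)
  moreover have "\<tau> = shift_perm \<sigma>"
  proof
    fix i
    show "\<tau> i = shift_perm \<sigma> i"
    proof (cases i)
      case (Suc j)
      show ?thesis
      proof (cases "j < n")
        case True
        then have "\<sigma> (Suc j - 1) = \<tau> (Suc j) - 1"
          unfolding \<sigma>_def by (intro map_permutation_apply inj) auto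
        moreover have "\<tau> (Suc j) \<in> ?A"
          using True permutes_in_image[OF tau] by auto
        ultimately show ?thesis using Suc by auto
      next
        case False
        then show ?thesis
          using Suc permutes_not_in[OF tau] permutes_not_in[OF \<open>\<sigma> permutes {..<n}\<close>] by auto
      qed
    qed (simp add: assms(2))
  qed
  ultimately show thesis using that by blast
qed

definition cycle_to_front :: "nat \<Rightarrow> nat \<Rightarrow> nat" where
  "cycle_to_front p i = (if i < p then Suc i else if i = p then 0 else i)"

lemma cycle_to_front_Suc:
  "cycle_to_front (Suc p) = cycle_to_front p \<circ> Transposition.transpose p (Suc p)"
  by (auto simp: fun_eq_iff cycle_to_front_def Transposition.transpose_def)

lemma cycle_to_front_0: "cycle_to_front 0 = id"
  by (auto simp: fun_eq_iff cycle_to_front_def)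

lemma cycle_to_front_permutes: "p \<le> n \<Longrightarrow> cycle_to_front p permutes {..<Suc n}"
proof (induction p)
  case (Suc p)
  then show ?case
    unfolding cycle_to_front_Suc by (intro permutes_compose permutes_swap_id) auto
qed (simp add: cycle_to_front_0 permutes_id)

lemma sign_cycle_to_front: "sign (cycle_to_front p) = (- 1) ^ p"
proof (induction p)
  case (Suc p)
  have "permutation (cycle_to_front p)"
    using cycle_to_front_permutes[of p p] by (auto simp: permutation_permutes)
  then show ?case
    unfolding cycle_to_front_Suc
    using Suc by (subst sign_compose) (simp_all add: permutation_swap_id sign_swap_id)
qed (simp add: cycle_to_front_0)

lemma permutes_sending_to_0E:
  assumes "\<tau> permutes {..<Suc n}" "p \<le> n" "\<tau> p = 0"
  obtains \<sigma> where "\<sigma> permutes {..<n}" "\<tau> = shift_perm \<sigma> \<circ> cycle_to_front p"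
proof -
  let ?c = "cycle_to_front p"
  have c: "?c permutes {..<Suc n}" using cycle_to_front_permutes[OF assms(2)] .
  have "(\<tau> \<circ> inv ?c) permutes {..<Suc n}"
    using permutes_compose[OF permutes_inv[OF c] assms(1)] .
  moreover have "inv ?c 0 = p"
    using permutes_inv_eq[OF c] by (simp add: cycle_to_front_def)
  ultimately obtain \<sigma> where "\<sigma> permutes {..<n}" "\<tau> \<circ> inv ?c = shift_perm \<sigma>"
    using assms(3) permutes_fixing_0E[of "\<tau> \<circ> inv ?c" n] by auto
  moreover have "\<tau> = (\<tau> \<circ> inv ?c) \<circ> ?c"
    using permutes_inv_o(2)[OF c] by (simp add: comp_assoc)
  ultimately show thesis using that by metis
qed

lemma strict_mono_on_shift_perm:
  "strict_mono_on {..<Suc p} (shift_perm \<sigma>) \<longleftrightarrow> strict_mono_on {..<p} \<sigma>"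
  "strict_mono_on {Suc p..<Suc n} (shift_perm \<sigma>) \<longleftrightarrow> strict_mono_on {p..<n} \<sigma>"
  unfolding lessThan_Suc_eq_insert_0 image_Suc_atLeastLessThan[symmetric]
  by (simp_all only: monotone_on_def ball_simps insert_iff image_iff bex_simps) auto

lemma strict_mono_on_shift_perm_cycle:
  "strict_mono_on {..<p} (shift_perm \<sigma> \<circ> cycle_to_front p) \<longleftrightarrow> strict_mono_on {..<p} \<sigma>"
  "p \<le> n \<Longrightarrow> strict_mono_on {p..<Suc n} (shift_perm \<sigma> \<circ> cycle_to_front p) \<longleftrightarrow>
    strict_mono_on {p..<n} \<sigma>"
proof -
  show "strict_mono_on {..<p} (shift_perm \<sigma> \<circ> cycle_to_front p) \<longleftrightarrow> strict_mono_on {..<p} \<sigma>"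
    by (auto simp: monotone_on_def cycle_to_front_def)
  assume "p \<le> n"
  then have set_eq: "{p..<Suc n} = insert p (Suc ` {p..<n})"
    unfolding image_Suc_atLeastLessThan by auto
  have mono_insert: "strict_mono_on (insert p (Suc ` A)) (shift_perm \<sigma> \<circ> cycle_to_front p) \<longleftrightarrow>
    strict_mono_on A \<sigma>" if "A \<subseteq> {p..}" for A
    using that by (auto simp: monotone_on_def cycle_to_front_def subset_eq)
  show "strict_mono_on {p..<Suc n} (shift_perm \<sigma> \<circ> cycle_to_front p) \<longleftrightarrow>
    strict_mono_on {p..<n} \<sigma>" unfolding set_eq by (rule mono_insert) auto
qed

lemma shuffle_perms_first_left:
  "{\<tau> \<in> shuffle_perms (Suc p) q. \<tau> 0 = 0} = shift_perm ` shuffle_perms p q"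
proof (intro equalityI subsetI)
  fix \<tau> assume "\<tau> \<in> {\<tau> \<in> shuffle_perms (Suc p) q. \<tau> 0 = 0}"
  then show "\<tau> \<in> shift_perm ` shuffle_perms p q"
    by (auto simp: shuffle_perms_def strict_mono_on_shift_perm elim!: permutes_fixing_0E)
qed (auto simp: shuffle_perms_def strict_mono_on_shift_perm intro: shift_perm_permutes)

lemma shuffle_perms_first_right:
  "{\<tau> \<in> shuffle_perms p (Suc q). \<tau> p = 0} =
    (\<lambda>\<sigma>. shift_perm \<sigma> \<circ> cycle_to_front p) ` shuffle_perms p q"
proof (intro equalityI subsetI)
  fix \<tau> assume tau: "\<tau> \<in> {\<tau> \<in> shuffle_perms p (Suc q). \<tau> p = 0}"
  then obtain \<sigma> where "\<sigma> permutes {..<p + q}" "\<tau> = shift_perm \<sigma> \<circ> cycle_to_front p"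
    using permutes_sending_to_0E[of \<tau> "p + q" p] by (auto simp: shuffle_perms_def)
  with tau show "\<tau> \<in> (\<lambda>\<sigma>. shift_perm \<sigma> \<circ> cycle_to_front p) ` shuffle_perms p q"
    by (auto simp del: o_apply simp: shuffle_perms_def strict_mono_on_shift_perm_cycle)
next
  fix \<tau> assume "\<tau> \<in> (\<lambda>\<sigma>. shift_perm \<sigma> \<circ> cycle_to_front p) ` shuffle_perms p q"
  then obtain \<sigma> where sigma: "\<sigma> \<in> shuffle_perms p q" "\<tau> = shift_perm \<sigma> \<circ> cycle_to_front p"
    by auto
  moreover from this have "\<tau> permutes {..<Suc (p + q)}"
    by (auto simp: shuffle_perms_def intro!: permutes_compose shift_perm_permutes cycle_to_front_permutes)
  moreover from sigma have "\<tau> p = 0" by (simp add: cycle_to_front_def)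
  ultimately show "\<tau> \<in> {\<tau> \<in> shuffle_perms p (Suc q). \<tau> p = 0}"
    by (auto simp del: o_apply simp: shuffle_perms_def strict_mono_on_shift_perm_cycle)
qed

text \<open>Blocks are increasing, so the least value is taken at the start of one of them.\<close>

lemma shuffle_perm_hits_0:
  assumes "\<tau> \<in> shuffle_perms p q" "0 < p + q"
  shows "0 < p \<and> \<tau> 0 = 0 \<or> 0 < q \<and> \<tau> p = 0"
proof -
  have tau: "\<tau> permutes {..<p + q}" using assms(1) by (simp add: shuffle_perms_def)
  then obtain i where i: "\<tau> i = 0" "i < p + q"
    using permutes_surj[OF tau] permutes_in_image[OF tau] assms(2)
    by (metis lessThan_iff surj_def)
  have l: "\<tau> j < \<tau> k" if "j < k" "k < p" for j k
    using assms(1) that by (auto simp: shuffle_perms_def monotone_on_def)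
  have r: "\<tau> j < \<tau> k" if "p \<le> j" "j < k" "k < p + q" for j k
    using assms(1) that by (auto simp: shuffle_perms_def monotone_on_def)
  show ?thesis
  proof (cases "i < p")
    case True
    with i l[of 0 i] show ?thesis by (cases "i = 0") auto
  next
    case False
    with i r[of p i] show ?thesis by (cases "i = p") auto
  qed
qed

lemma finite_shuffle_perms: "finite (shuffle_perms p q)"
  by (rule finite_subset[OF _ finite_permutations[of "{..<p + q}"]]) (auto simp: shuffle_perms_def)

text \<open>The grading involution, which makes the signs of graded derivations of odd degree expressible
  for operators of mixed degree.\<close>

definition degree_sign :: "('m, 'v) oper \<Rightarrow> ('m, 'v) oper" where
  "degree_sign c = (\<lambda>Xs. (- 1 :: real) ^ length Xs *\<^sub>R c Xs)"

lemma shuffle_prod_Nil: "shuffle_prod c d [] = c [] * d []"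
proof -
  have "shuffle_perms 0 0 = {id}" by (auto simp: shuffle_perms_def)
  then show ?thesis by (simp add: shuffle_prod_def)
qed

text \<open>The graded Leibniz rule for contractions, evaluated on a list; it replaces the sum over shuffles
  by a recursion on the list of arguments.\<close>

lemma shuffle_prod_Cons:
  "shuffle_prod c d (X # Xs) =
     shuffle_prod (contraction X c) d Xs + shuffle_prod (degree_sign c) (contraction X d) Xs"
proof -
  define n where "n = length Xs"
  define F where "F p \<tau> = real_of_int (sign \<tau>) *\<^sub>R
       (c (map (\<lambda>i. (X # Xs) ! \<tau> i) [0..<p]) * d (map (\<lambda>i. (X # Xs) ! \<tau> i) [p..<Suc n]))"
    for p and \<tau> :: "nat \<Rightarrow> nat"
  \<comment> \<open>The first argument goes to the left factor in \<open>A p\<close>, to the right factor in \<open>B p\<close>.\<close>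
  define A where "A p = {\<tau> \<in> shuffle_perms p (Suc n - p). 0 < p \<and> \<tau> 0 = 0}" for p
  define B where "B p = {\<tau> \<in> shuffle_perms p (Suc n - p). p \<le> n \<and> \<tau> p = 0}" for p
  have split: "(\<Sum>\<tau>\<in>shuffle_perms p (Suc n - p). F p \<tau>) = (\<Sum>\<tau>\<in>A p. F p \<tau>) + (\<Sum>\<tau>\<in>B p. F p \<tau>)"
    if p: "p \<le> Suc n" for p
  proof -
    have "shuffle_perms p (Suc n - p) = A p \<union> B p"
      using shuffle_perm_hits_0[of _ p "Suc n - p"] p by (fastforce simp: A_def B_def)
    moreover have "A p \<inter> B p = {}"
    proof -
      have False if "\<tau> \<in> A p" "\<tau> \<in> B p" for \<tau>
      proof -
        have "inj \<tau>" "\<tau> 0 = \<tau> p" "0 < p"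
          using that by (auto simp: A_def B_def shuffle_perms_def permutes_inj)
        then show False by (auto dest: injD)
      qed
      then show ?thesis by blast
    qed
    moreover have "finite (A p)" "finite (B p)"
      by (auto simp: A_def B_def intro: finite_subset[OF _ finite_shuffle_perms])
    ultimately show ?thesis by (simp add: sum.union_disjoint)
  qed
  have "(\<Sum>p\<le>Suc n. \<Sum>\<tau>\<in>A p. F p \<tau>) = (\<Sum>p\<le>n. \<Sum>\<tau>\<in>A (Suc p). F (Suc p) \<tau>)"
    by (subst sum.atMost_Suc_shift) (simp add: A_def)
  also have "\<dots> = shuffle_prod (contraction X c) d Xs"
    unfolding shuffle_prod_def n_def[symmetric]
  proof (rule sum.cong[OF refl])
    fix p assume "p \<in> {..n}"
    have A: "A (Suc p) = shift_perm ` shuffle_perms p (n - p)"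
      using shuffle_perms_first_left[of p "n - p"] by (simp add: A_def)
    show "(\<Sum>\<tau>\<in>A (Suc p). F (Suc p) \<tau>) =
      (\<Sum>\<sigma>\<in>shuffle_perms p (n - p). real_of_int (sign \<sigma>) *\<^sub>R
         (contraction X c (map (\<lambda>i. Xs ! \<sigma> i) [0..<p]) * d (map (\<lambda>i. Xs ! \<sigma> i) [p..<n])))"
      unfolding A
    proof (subst sum.reindex[OF inj_on_subset[OF inj_shift_perm subset_UNIV]], rule sum.cong[OF refl])
      fix \<sigma> assume "\<sigma> \<in> shuffle_perms p (n - p)"
      then have "sign (shift_perm \<sigma>) = sign \<sigma>"
        by (auto simp: shuffle_perms_def intro: sign_shift_perm)
      moreover have "map (\<lambda>i. (X # Xs) ! shift_perm \<sigma> i) [0..<Suc p] = X # map (\<lambda>i. Xs ! \<sigma> i) [0..<p]"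
        unfolding upt_conv_Cons[OF zero_less_Suc] map_Suc_upt[symmetric] by simp
      moreover have "map (\<lambda>i. (X # Xs) ! shift_perm \<sigma> i) [Suc p..<Suc n] = map (\<lambda>i. Xs ! \<sigma> i) [p..<n]"
        unfolding map_Suc_upt[symmetric] by simp
      ultimately show "(F (Suc p) \<circ> shift_perm) \<sigma> = real_of_int (sign \<sigma>) *\<^sub>R
         (contraction X c (map (\<lambda>i. Xs ! \<sigma> i) [0..<p]) * d (map (\<lambda>i. Xs ! \<sigma> i) [p..<n]))"
        unfolding o_apply F_def contraction_def by (simp only:)
    qed
  qed
  finally have left: "(\<Sum>p\<le>Suc n. \<Sum>\<tau>\<in>A p. F p \<tau>) = shuffle_prod (contraction X c) d Xs" .
  have "(\<Sum>p\<le>Suc n. \<Sum>\<tau>\<in>B p. F p \<tau>) = (\<Sum>p\<le>n. \<Sum>\<tau>\<in>B p. F p \<tau>)"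
    by (simp add: B_def)
  also have "\<dots> = shuffle_prod (degree_sign c) (contraction X d) Xs"
    unfolding shuffle_prod_def n_def[symmetric]
  proof (rule sum.cong[OF refl])
    fix p assume "p \<in> {..n}"
    then have p: "p \<le> n" by simp
    let ?\<kappa> = "\<lambda>\<sigma>. shift_perm \<sigma> \<circ> cycle_to_front p"
    have B: "B p = ?\<kappa> ` shuffle_perms p (n - p)"
      using shuffle_perms_first_right[of p "n - p"] p by (simp add: B_def Suc_diff_le)
    have inj: "inj_on ?\<kappa> (shuffle_perms p (n - p))"
    proof (rule inj_onI)
      fix \<sigma> \<tau> assume "?\<kappa> \<sigma> = ?\<kappa> \<tau>"
      then have "?\<kappa> \<sigma> \<circ> inv (cycle_to_front p) = ?\<kappa> \<tau> \<circ> inv (cycle_to_front p)" by simp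
      then have "shift_perm \<sigma> = shift_perm \<tau>"
        by (simp add: comp_assoc permutes_inv_o(1)[OF cycle_to_front_permutes[OF order_refl]])
      then show "\<sigma> = \<tau>" using inj_shift_perm by (simp add: inj_eq)
    qed
    show "(\<Sum>\<tau>\<in>B p. F p \<tau>) =
      (\<Sum>\<sigma>\<in>shuffle_perms p (n - p). real_of_int (sign \<sigma>) *\<^sub>R
         (degree_sign c (map (\<lambda>i. Xs ! \<sigma> i) [0..<p]) *
          contraction X d (map (\<lambda>i. Xs ! \<sigma> i) [p..<n])))"
      unfolding B
    proof (subst sum.reindex[OF inj], rule sum.cong[OF refl])
      fix \<sigma> assume s: "\<sigma> \<in> shuffle_perms p (n - p)"
      then have sigma: "\<sigma> permutes {..<n}" using p by (simp add: shuffle_perms_def)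
      have "permutation (shift_perm \<sigma>)" "permutation (cycle_to_front p)"
        using shift_perm_permutes[OF sigma] cycle_to_front_permutes[OF p]
        by (auto simp: permutation_permutes)
      then have "sign (?\<kappa> \<sigma>) = sign \<sigma> * (- 1) ^ p"
        by (simp add: sign_compose sign_shift_perm[OF sigma] sign_cycle_to_front)
      moreover have "map (\<lambda>i. (X # Xs) ! ?\<kappa> \<sigma> i) [0..<p] = map (\<lambda>i. Xs ! \<sigma> i) [0..<p]"
        by (simp add: cycle_to_front_def)
      moreover have "map (\<lambda>i. (X # Xs) ! ?\<kappa> \<sigma> i) [p..<Suc n] = X # map (\<lambda>i. Xs ! \<sigma> i) [p..<n]"
        unfolding upt_conv_Cons[OF le_imp_less_Suc[OF p]] map_Suc_upt[symmetric]
        by (simp add: cycle_to_front_def)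
      ultimately have "F p (?\<kappa> \<sigma>) = real_of_int (sign \<sigma> * (- 1) ^ p) *\<^sub>R
          (c (map (\<lambda>i. Xs ! \<sigma> i) [0..<p]) * d (X # map (\<lambda>i. Xs ! \<sigma> i) [p..<n]))"
        unfolding F_def by (simp only:)
      then show "(F p \<circ> ?\<kappa>) \<sigma> = real_of_int (sign \<sigma>) *\<^sub>R
         (degree_sign c (map (\<lambda>i. Xs ! \<sigma> i) [0..<p]) *
          contraction X d (map (\<lambda>i. Xs ! \<sigma> i) [p..<n]))"
        by (simp add: fun_eq_iff contraction_def degree_sign_def)
    qed
  qed
  finally have right: "(\<Sum>p\<le>Suc n. \<Sum>\<tau>\<in>B p. F p \<tau>) =
    shuffle_prod (degree_sign c) (contraction X d) Xs" .
  have "shuffle_prod c d (X # Xs) = (\<Sum>p\<le>Suc n. \<Sum>\<tau>\<in>shuffle_perms p (Suc n - p). F p \<tau>)"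
    unfolding shuffle_prod_def F_def n_def by simp
  also have "\<dots> = (\<Sum>p\<le>Suc n. (\<Sum>\<tau>\<in>A p. F p \<tau>) + (\<Sum>\<tau>\<in>B p. F p \<tau>))"
    by (rule sum.cong[OF refl]) (use split in simp)
  also have "\<dots> = shuffle_prod (contraction X c) d Xs + shuffle_prod (degree_sign c) (contraction X d) Xs"
    unfolding sum.distrib left right ..
  finally show ?thesis .
qed

lemma contraction_shuffle_prod:
  "contraction X (shuffle_prod c d) =
     shuffle_prod (contraction X c) d + shuffle_prod (degree_sign c) (contraction X d)"
  by (rule ext) (simp only: contraction_def[of X "shuffle_prod c d"] shuffle_prod_Cons plus_fun_apply)

lemma contraction_degree_sign: "contraction X (degree_sign c) = - degree_sign (contraction X c)"
  by (simp add: contraction_def degree_sign_def fun_eq_iff)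

lemma degree_sign_diff: "degree_sign (a - b) = degree_sign a - degree_sign b"
  by (simp add: degree_sign_def fun_eq_iff right_diff_distrib)

lemma degree_sign_degree_sign: "degree_sign (degree_sign c) = c"
  by (simp add: degree_sign_def fun_eq_iff flip: power_add mult_2 mult.assoc)

lemma shuffle_prod_scaleR:
  fixes a b :: "('m, 'v) oper"
  shows "shuffle_prod (r *\<^sub>R a) b = r *\<^sub>R shuffle_prod a b"
proof -
  have "(r *\<^sub>R f) * g = r *\<^sub>R (f * g)" for f g :: "'m \<Rightarrow> real"
    by (simp add: fun_eq_iff)
  then show ?thesis
    by (intro ext) (simp only: shuffle_prod_def scaleR_fun_apply[of r a]
        scaleR_fun_apply[of r "\<lambda>Xs. \<Sum>p\<le>length Xs. _ p Xs"] scaleR_sum_right scaleR_left_commute)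
qed

lemma shuffle_prod_diff:
  "shuffle_prod (a - b) c = shuffle_prod a c - shuffle_prod b c"
  "shuffle_prod c (a - b) = shuffle_prod c a - shuffle_prod c b"
  by (intro ext; simp only: shuffle_prod_def minus_apply left_diff_distrib
      right_diff_distrib scaleR_diff_right sum_subtractf)+

lemma shuffle_prod_zero: "shuffle_prod 0 b = 0" "shuffle_prod b 0 = 0"
  using shuffle_prod_diff(1)[of b b b] shuffle_prod_diff(2)[of b b b] by simp_all

lemma shuffle_prod_minus:
  "shuffle_prod (- a) b = - shuffle_prod a b" "shuffle_prod a (- b) = - shuffle_prod a b"
  using shuffle_prod_diff(1)[of 0 a b] shuffle_prod_diff(2)[of a 0 b]
  by (simp_all add: shuffle_prod_zero)

section \<open>Linear differential operators between modules of functions\<close>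

lemma fmul_apply: "(f \<odot> X) x = f x *\<^sub>R X x"
  by (simp add: fmul_def)

lemma fmul_eq_times: "f \<odot> g = f * (g :: 'm \<Rightarrow> real)"
  by (simp add: fun_eq_iff fmul_apply)

lemma fmul_simps:
  "f \<odot> (X + Y) = f \<odot> X + f \<odot> Y" "f \<odot> (X - Y) = f \<odot> X - f \<odot> Y"
  "f \<odot> (r *\<^sub>R X) = r *\<^sub>R (f \<odot> X)" "f \<odot> 0 = 0"
  by (simp_all add: fun_eq_iff fmul_apply scaleR_right_distrib scaleR_right_diff_distrib)

definition function_module :: "('m \<Rightarrow> real) set \<Rightarrow> ('m \<Rightarrow> 'v::real_vector) set \<Rightarrow> bool" where
  "function_module C T \<longleftrightarrow> subspace T \<and> (\<forall>f\<in>C. \<forall>X\<in>T. f \<odot> X \<in> T)"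

lemma function_moduleD:
  assumes "function_module C T"
  shows "0 \<in> T" "X \<in> T \<Longrightarrow> Y \<in> T \<Longrightarrow> X + Y \<in> T" "X \<in> T \<Longrightarrow> Y \<in> T \<Longrightarrow> X - Y \<in> T"
    "X \<in> T \<Longrightarrow> r *\<^sub>R X \<in> T" "f \<in> C \<Longrightarrow> X \<in> T \<Longrightarrow> f \<odot> X \<in> T"
  using assms by (auto simp: function_module_def subspace_0 subspace_add subspace_diff subspace_scale)

lemma linear_betweenD:
  assumes "linear_between S T A"
  shows "X \<in> S \<Longrightarrow> A X \<in> T" "X \<in> S \<Longrightarrow> Y \<in> S \<Longrightarrow> A (X + Y) = A X + A Y"
    "X \<in> S \<Longrightarrow> A (r *\<^sub>R X) = r *\<^sub>R A X"
  using assms by (auto simp: linear_between_def)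

lemma linear_between_0: "linear_between S T A \<Longrightarrow> 0 \<in> S \<Longrightarrow> A 0 = 0"
  using linear_betweenD(3)[of S T A 0 0] by simp

lemma linear_between_diff:
  assumes "linear_between S T A" "subspace S" "X \<in> S" "Y \<in> S"
  shows "A (X - Y) = A X - A Y"
  using linear_betweenD(2)[OF assms(1), of X "(- 1) *\<^sub>R Y"]
    linear_betweenD(3)[OF assms(1), of Y "- 1"] assms subspace_scale[of S Y "- 1"] by simp

definition mult_commutator ::
  "('m \<Rightarrow> real) \<Rightarrow> (('m \<Rightarrow> 'v::real_vector) \<Rightarrow> 'm \<Rightarrow> 'w::real_vector) \<Rightarrow> ('m \<Rightarrow> 'v) \<Rightarrow> 'm \<Rightarrow> 'w"
  where "mult_commutator f A X = A (f \<odot> X) - f \<odot> A X"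

lemma linear_between_mult_commutator:
  assumes "function_module C S" "function_module C T" "f \<in> C" "linear_between S T A"
  shows "linear_between S T (mult_commutator f A)"
  unfolding linear_between_def mult_commutator_def
  using function_moduleD[OF assms(1)] function_moduleD[OF assms(2)] linear_betweenD[OF assms(4)] assms(3)
  by (auto simp: fmul_simps scaleR_diff_right)

text \<open>Operators of order less than \<open>n\<close>, by recursion on iterated commutators with multiplications.
  The strict bound makes the zero operator the base case, so that inductions start trivially.\<close>

primrec diff_order_less ::
  "('m \<Rightarrow> real) set \<Rightarrow> ('m \<Rightarrow> 'v::real_vector) set \<Rightarrow> ('m \<Rightarrow> 'w::real_vector) set \<Rightarrow> nat \<Rightarrow>
    (('m \<Rightarrow> 'v) \<Rightarrow> 'm \<Rightarrow> 'w) \<Rightarrow> bool" where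
  "diff_order_less C S T 0 A \<longleftrightarrow> linear_between S T A \<and> (\<forall>X\<in>S. A X = 0)"
| "diff_order_less C S T (Suc n) A \<longleftrightarrow>
     linear_between S T A \<and> (\<forall>f\<in>C. diff_order_less C S T n (mult_commutator f A))"

lemma diff_order_less_linear: "diff_order_less C S T n A \<Longrightarrow> linear_between S T A"
  by (cases n) auto

lemma linear_between_cong:
  assumes "subspace S" "\<And>X. X \<in> S \<Longrightarrow> A X = B X"
  shows "linear_between S T A \<longleftrightarrow> linear_between S T B"
  using assms by (auto simp: linear_between_def subspace_def)

lemma diff_order_less_cong:
  assumes "function_module C S" "\<And>X. X \<in> S \<Longrightarrow> A X = B X"
  shows "diff_order_less C S T n A \<longleftrightarrow> diff_order_less C S T n B"
  using assms(2)
proof (induction n arbitrary: A B)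
  case 0
  then show ?case
    using linear_between_cong[of S A B T] assms(1) by (auto simp: function_module_def)
next
  case (Suc n)
  have "diff_order_less C S T n (mult_commutator f A) \<longleftrightarrow> diff_order_less C S T n (mult_commutator f B)"
    if "f \<in> C" for f
    using Suc.prems that function_moduleD(5)[OF assms(1)]
    by (intro Suc.IH) (simp add: mult_commutator_def)
  then show ?case
    using linear_between_cong[of S A B T] assms(1) Suc.prems by (auto simp: function_module_def)
qed

lemma diff_order_less_zero:
  fixes S :: "('m \<Rightarrow> 'v::real_vector) set" and T :: "('m \<Rightarrow> 'w::real_vector) set"
  assumes "function_module C S" "function_module C T"
  shows "diff_order_less C S T n (\<lambda>X. 0)"
proof (induction n)
  case 0
  then show ?case using function_moduleD[OF assms(2)] by (simp add: linear_between_def del: zero_fun_apply)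
next
  case (Suc n)
  have "mult_commutator f (\<lambda>X :: 'm \<Rightarrow> 'v. 0 :: 'm \<Rightarrow> 'w) = (\<lambda>X. 0)" for f
    by (rule ext) (simp only: mult_commutator_def fmul_simps diff_self)
  then show ?case
    using Suc diff_order_less_linear[OF Suc] by (simp del: zero_fun_apply)
qed

lemma diff_order_less_vanishing:
  assumes "function_module C S" "function_module C T" "\<And>X. X \<in> S \<Longrightarrow> A X = 0"
  shows "diff_order_less C S T n A"
  using diff_order_less_cong[OF assms(1), of A "\<lambda>X. 0"] diff_order_less_zero[OF assms(1,2)] assms(3)
  by blast

lemma diff_order_less_mono:
  assumes S: "function_module C S" and T: "function_module C T"
    and A: "diff_order_less C S T n A" and le: "n \<le> m"
  shows "diff_order_less C S T m A"
  using le A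
proof (induction m arbitrary: n A)
  case (Suc m)
  show ?case
  proof (cases n)
    case 0
    with Suc.prems show ?thesis by (intro diff_order_less_vanishing S T) (simp add: zero_fun_def)
  next
    case (Suc k)
    with Suc.prems Suc.IH[of k] show ?thesis by simp
  qed
qed simp

lemma diff_order_less_add:
  assumes S: "function_module C S" and T: "function_module C T"
    and "diff_order_less C S T n A" "diff_order_less C S T n B"
  shows "diff_order_less C S T n (\<lambda>X. A X + B X)"
  using assms(3,4)
proof (induction n arbitrary: A B)
  case 0
  then show ?case by (intro diff_order_less_vanishing S T) (simp add: zero_fun_def)
next
  case (Suc n)
  have "mult_commutator f (\<lambda>X. A X + B X) = (\<lambda>X. mult_commutator f A X + mult_commutator f B X)" for f
    by (rule ext) (simp add: mult_commutator_def fmul_simps)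
  moreover have "linear_between S T (\<lambda>X. A X + B X)"
    using Suc.prems function_moduleD[OF T]
    by (auto simp: linear_between_def scaleR_right_distrib)
  ultimately show ?case using Suc by (simp del: plus_fun_apply scaleR_fun_apply)
qed

lemma diff_order_less_scaleR:
  assumes S: "function_module C S" and T: "function_module C T"
    and "diff_order_less C S T n A"
  shows "diff_order_less C S T n (\<lambda>X. r *\<^sub>R A X)"
  using assms(3)
proof (induction n arbitrary: A)
  case 0
  then show ?case by (intro diff_order_less_vanishing S T) (simp add: zero_fun_def)
next
  case (Suc n)
  have "mult_commutator f (\<lambda>X. r *\<^sub>R A X) = (\<lambda>X. r *\<^sub>R mult_commutator f A X)" for f
    by (rule ext) (simp add: mult_commutator_def fmul_simps scaleR_diff_right)
  moreover have "linear_between S T (\<lambda>X. r *\<^sub>R A X)"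
    using Suc.prems function_moduleD[OF T]
    by (auto simp: linear_between_def scaleR_right_distrib)
  ultimately show ?case using Suc by (simp del: plus_fun_apply scaleR_fun_apply)
qed

lemma diff_order_less_sum:
  assumes "function_module C S" "function_module C T"
    and "\<And>i. i \<in> I \<Longrightarrow> diff_order_less C S T n (A i)"
  shows "diff_order_less C S T n (\<lambda>X. \<Sum>i\<in>I. A i X)"
  using assms(3)
  by (induction I rule: infinite_finite_induct)
    (simp_all add: diff_order_less_zero[OF assms(1,2)] diff_order_less_add[OF assms(1,2)])

text \<open>The commutator is a derivation of composition:
  \<open>[A \<circ> B, f] = A \<circ> [B, f] + [A, f] \<circ> B\<close>.\<close>

lemma diff_order_less_comp:
  assumes S: "function_module C S" and T: "function_module C T" and U: "function_module C U"
    and "diff_order_less C S T m B" "diff_order_less C T U n A"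
  shows "diff_order_less C S U (m + n) (\<lambda>X. A (B X))"
  using assms(4,5)
proof (induction "m + n" arbitrary: m n A B)
  case (Suc k)
  note B = diff_order_less_linear[OF Suc.prems(1)] and A = diff_order_less_linear[OF Suc.prems(2)]
  have lin: "linear_between S U (\<lambda>X. A (B X))"
    using A B by (simp add: linear_between_def)
  show ?case
  proof (cases "m = 0 \<or> n = 0")
    case True
    have "A (B X) = 0" if "X \<in> S" for X
      using True Suc.prems that linear_betweenD[OF B]
        linear_between_0[OF A function_moduleD(1)[OF T]] by (auto simp: zero_fun_def)
    then show ?thesis by (intro diff_order_less_vanishing S U)
  next
    case False
    then obtain m' n' where mn: "m = Suc m'" "n = Suc n'"
      using not0_implies_Suc by blast
    have "diff_order_less C S U k (mult_commutator f (\<lambda>X. A (B X)))" if f: "f \<in> C" for f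
    proof -
      have "k = m' + n" "k = m + n'" using Suc.hyps(2) mn by auto
      moreover have "diff_order_less C S T m' (mult_commutator f B)"
        "diff_order_less C T U n' (mult_commutator f A)"
        using Suc.prems mn f by auto
      ultimately have "diff_order_less C S U k (\<lambda>X. A (mult_commutator f B X))"
        "diff_order_less C S U k (\<lambda>X. mult_commutator f A (B X))"
        using Suc.hyps(1)[of m' n "mult_commutator f B" A]
          Suc.hyps(1)[of m n' B "mult_commutator f A"] Suc.prems by simp_all
      then have "diff_order_less C S U k (\<lambda>X. A (mult_commutator f B X) + mult_commutator f A (B X))"
        by (rule diff_order_less_add[OF S U])
      moreover have "A (mult_commutator f B X) = A (B (f \<odot> X)) - A (f \<odot> B X)" if "X \<in> S" for X
        unfolding mult_commutator_def
        using that f linear_betweenD(1)[OF B] function_moduleD(5)[OF S] function_moduleD(5)[OF T] T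
        by (intro linear_between_diff[OF A]) (auto simp: function_module_def)
      then have "A (mult_commutator f B X) + mult_commutator f A (B X) =
          mult_commutator f (\<lambda>X. A (B X)) X" if "X \<in> S" for X
        using that by (simp add: mult_commutator_def)
      ultimately show ?thesis
        using diff_order_less_cong[OF S] by (metis (no_types, lifting))
    qed
    then show ?thesis
      using lin Suc.hyps(2)[symmetric] by simp
  qed
next
  case 0
  then show ?case
    using linear_between_0[of T U A] function_moduleD(1)[OF T] 
    by (intro diff_order_less_vanishing S U) (auto simp del: zero_fun_apply)
qed

lemma diff_order_less_function_linear:
  assumes "function_module C S" "function_module C T" "linear_between S T A"
    and "\<And>f X. f \<in> C \<Longrightarrow> X \<in> S \<Longrightarrow> A (f \<odot> X) = f \<odot> A X"
  shows "diff_order_less C S T 1 A"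
  using assms linear_between_mult_commutator[OF assms(1,2) _ assms(3)]
  by (simp add: mult_commutator_def)

text \<open>The next two lemmas connect this recursion, one argument at a time, with the iterated slot
  commutators that define multidifferential operators.\<close>

lemma diff_order_less_iff_foldr:
  assumes S: "function_module C S" and T: "function_module C T"
  shows "diff_order_less C S T n A \<longleftrightarrow> linear_between S T A \<and>
    (\<forall>fs X. length fs = n \<and> set fs \<subseteq> C \<and> X \<in> S \<longrightarrow> foldr mult_commutator fs A X = 0)"
proof (induction n arbitrary: A)
  case (Suc n)
  \<comment> \<open>The recursion takes the innermost commutator first, which is the last entry of the list.\<close>
  have split: "(\<forall>fs. length fs = Suc n \<and> set fs \<subseteq> C \<longrightarrow> P fs) \<longleftrightarrow>
      (\<forall>f\<in>C. \<forall>fs. length fs = n \<and> set fs \<subseteq> C \<longrightarrow> P (fs @ [f]))" for P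
  proof (intro iffI allI impI)
    fix fs assume R: "\<forall>f\<in>C. \<forall>fs. length fs = n \<and> set fs \<subseteq> C \<longrightarrow> P (fs @ [f])"
      and fs: "length fs = Suc n \<and> set fs \<subseteq> C"
    then show "P fs" by (cases fs rule: rev_cases) auto
  qed auto
  have "(\<forall>fs X. length fs = Suc n \<and> set fs \<subseteq> C \<and> X \<in> S \<longrightarrow> foldr mult_commutator fs A X = 0) \<longleftrightarrow>
      (\<forall>f\<in>C. \<forall>fs. length fs = n \<and> set fs \<subseteq> C \<longrightarrow>
        (\<forall>X\<in>S. foldr mult_commutator fs (mult_commutator f A) X = 0))"
    using split[of "\<lambda>fs. \<forall>X\<in>S. foldr mult_commutator fs A X = 0"] by simp blast
  then show ?case
    using Suc linear_between_mult_commutator[OF S T] by auto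
qed auto

lemma foldr_slot_comm:
  assumes "i < length Xs"
  shows "foldr (slot_comm i) fs c (Xs[i := Z]) = foldr mult_commutator fs (\<lambda>X. c (Xs[i := X])) Z"
proof (induction fs arbitrary: Z)
  case (Cons f fs)
  then show ?case
    using assms by (simp add: slot_comm_def mult_commutator_def fmul_eq_times)
qed simp

section \<open>Lists with an omitted entry\<close>

lemma length_omit: "i < length Xs \<Longrightarrow> length (omit i Xs) = length Xs - 1"
  by (simp add: omit_def)

lemma set_omit_subset: "set (omit i Xs) \<subseteq> set Xs"
  by (auto simp: omit_def dest: in_set_takeD in_set_dropD)

lemma omit_Cons: "omit 0 (X # Xs) = Xs" "omit (Suc i) (X # Xs) = X # omit i Xs"
  by (simp_all add: omit_def)

lemma omit_update_same: "omit i (Xs[i := Z]) = omit i Xs"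
  by (simp add: omit_def)

lemma omit_update:
  assumes "l \<noteq> i" "l < length Xs"
  shows "omit i (Xs[l := Z]) = (omit i Xs)[(if l < i then l else l - 1) := Z]"
proof (cases "l < i")
  case True
  then show ?thesis
    using assms by (simp add: omit_def take_update_swap list_update_append)
next
  case False
  with assms have "i < l" by simp
  then show ?thesis
    using assms by (auto simp: omit_def drop_update_swap list_update_append)
qed

section \<open>Anchor and bracket\<close>

locale loday_algebroid_on_bundle =
  fixes M :: "('m::{t2_space,second_countable_topology}, 'e::real_inner) manifold"
    and E :: "('m, 'k, 'v::real_vector) vbundle"
    and L :: "('m, 'v) loday_structure"
  assumes manifold: "smooth_manifold M"
    and vbundle: "vector_bundle M E"
    and loday: "loday_algebroid M E L"
begin

abbreviation S where "S \<equiv> sections M E"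
abbreviation C where "C \<equiv> smooth_funs M"
abbreviation act where "act \<equiv> anchor_act L"
abbreviation br where "br \<equiv> bracket L"
abbreviation d where "d \<equiv> coboundary M E L"
abbreviation lie where "lie \<equiv> lie_derivative M E L"

lemma module_sections: "function_module C S"
  using subspace_sections[OF manifold vbundle] sections_fmul[OF manifold vbundle]
  by (auto simp: function_module_def)

lemma module_functions: "function_module C C"
  using subspace_smooth_funs[OF manifold] smooth_funs_mult[OF manifold]
  by (auto simp: function_module_def fmul_eq_times)

lemma bracket_linear_right: "X \<in> S \<Longrightarrow> linear_between S S (\<lambda>Y. br X Y)"
  and bracket_linear_left: "Y \<in> S \<Longrightarrow> linear_between S S (\<lambda>X. br X Y)"
  and jacobi: "X \<in> S \<Longrightarrow> Y \<in> S \<Longrightarrow> Z \<in> S \<Longrightarrow>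
    br X (br Y Z) = br (br X Y) Z + br Y (br X Z)"
  and anchor_morphism: "bundle_morphism M E (tangent_bundle M) (anchor L)"
  and left_anchor_morphism: "bundle_morphism M E (tangent_end_bundle M E) (left_anchor L)"
  and bracket_fmul_right: "X \<in> S \<Longrightarrow> Y \<in> S \<Longrightarrow> f \<in> C \<Longrightarrow>
    br X (f \<odot> Y) = f \<odot> br X Y + act X f \<odot> Y"
  and bracket_fmul_left: "X \<in> S \<Longrightarrow> Y \<in> S \<Longrightarrow> f \<in> C \<Longrightarrow>
    br (f \<odot> X) Y = f \<odot> br X Y - act Y f \<odot> X + left_anchor_act M L Y f X"
  using loday unfolding loday_algebroid_def by blast+

lemma bracket_closed: "X \<in> S \<Longrightarrow> Y \<in> S \<Longrightarrow> br X Y \<in> S"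
  using linear_betweenD(1)[OF bracket_linear_right] .

lemma anchor_linear: "linear_between (fibre E x) (tangent_space M x) (anchor L x)"
  using anchor_morphism by (auto simp: bundle_morphism_def tangent_bundle_def)

lemma anchor_in_tangent_space: "X \<in> S \<Longrightarrow> anchor L x (X x) \<in> tangent_space M x"
  using linear_betweenD(1)[OF anchor_linear] section_in_fibre by blast

lemma act_linear_function: "X \<in> S \<Longrightarrow> linear_between C C (act X)"
  using anchor_in_tangent_space[of X]
    smooth_anchor_act[OF manifold vbundle anchor_morphism]
  by (simp add: linear_between_def tangent_space_def anchor_act_def fun_eq_iff)

lemma act_times:
  "X \<in> S \<Longrightarrow> f \<in> C \<Longrightarrow> g \<in> C \<Longrightarrow> act X (f * g) = act X f * g + f * act X g"
  using anchor_in_tangent_space[of X]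
  by (simp add: tangent_space_def anchor_act_def fun_eq_iff)

lemma act_linear_section: "f \<in> C \<Longrightarrow> linear_between S C (\<lambda>X. act X f)"
  unfolding linear_between_def
  using linear_betweenD(2,3)[OF anchor_linear] section_in_fibre[of _ M E]
    linear_betweenD(1)[OF act_linear_function]
  by (simp add: anchor_act_def fun_eq_iff)

lemma act_fmul: "X \<in> S \<Longrightarrow> act (f \<odot> X) g = f \<odot> act X g"
  using linear_betweenD(3)[OF anchor_linear] section_in_fibre[of _ M E]
  by (simp add: anchor_act_def fun_eq_iff fmul_apply)

lemmas act_closed = linear_betweenD(1)[OF act_linear_function]
  and act_add = linear_betweenD(2)[OF act_linear_function]
  and act_scaleR = linear_betweenD(3)[OF act_linear_function]

lemma act_0: "X \<in> S \<Longrightarrow> act X 0 = 0"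
  using linear_between_0[OF act_linear_function] function_moduleD(1)[OF module_functions] by blast

text \<open>Applying the Jacobi identity to \<open>X\<close>, \<open>Y\<close>, \<open>fZ\<close> shows that the defect of the homomorphism
  property, evaluated on \<open>f\<close>, annihilates every section \<open>Z\<close>.  At a given point \<open>Z\<close> may be taken to
  be whichever of \<open>X\<close>, \<open>Y\<close>, \<open>[X,Y]\<close> does not vanish there; if all three vanish, so does every term
  of the defect.\<close>

lemma act_bracket:
  assumes X: "X \<in> S" and Y: "Y \<in> S" and f: "f \<in> C"
  shows "act (br X Y) f = act X (act Y f) - act Y (act X f)"
proof
  fix x
  define \<delta> where "\<delta> = act X (act Y f) - act Y (act X f) - act (br X Y) f"
  have defect: "\<delta> x *\<^sub>R Z x = 0" if Z: "Z \<in> S" for Z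
  proof -
    have expand: "br A (br B (f \<odot> Z)) x = f x *\<^sub>R br A (br B Z) x + act A f x *\<^sub>R br B Z x +
        act B f x *\<^sub>R br A Z x + act A (act B f) x *\<^sub>R Z x" if A: "A \<in> S" and B: "B \<in> S" for A B
    proof -
      have "br A (br B (f \<odot> Z)) = br A (f \<odot> br B Z + act B f \<odot> Z)"
        by (simp only: bracket_fmul_right[OF B Z f])
      also have "\<dots> = br A (f \<odot> br B Z) + br A (act B f \<odot> Z)"
        by (intro linear_betweenD(2)[OF bracket_linear_right[OF A]]
            function_moduleD(5)[OF module_sections] f Z B act_closed bracket_closed)
      also have "\<dots> = f \<odot> br A (br B Z) + act A f \<odot> br B Z +
          (act B f \<odot> br A Z + act A (act B f) \<odot> Z)"
        using A B Z f by (simp only: bracket_fmul_right bracket_closed act_closed)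
      finally show ?thesis by (simp add: fmul_apply algebra_simps)
    qed
    have "f \<odot> Z \<in> S" using f Z function_moduleD(5)[OF module_sections] by blast
    then have "br X (br Y (f \<odot> Z)) x = br (br X Y) (f \<odot> Z) x + br Y (br X (f \<odot> Z)) x"
      using jacobi[OF X Y] by simp
    moreover have "br X (br Y Z) x = br (br X Y) Z x + br Y (br X Z) x"
      using jacobi[OF X Y Z] by simp
    ultimately show ?thesis
      using bracket_fmul_right[OF bracket_closed[OF X Y] Z f]
      unfolding expand[OF X Y] expand[OF Y X]
      by (simp add: \<delta>_def fmul_apply algebra_simps)
  qed
  show "act (br X Y) f x = (act X (act Y f) - act Y (act X f)) x"
  proof (cases "X x = 0 \<and> Y x = 0 \<and> br X Y x = 0")
    case True
    have "anchor L x 0 = 0"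
      using linear_between_0[OF anchor_linear] subspace_0[OF subspace_fibre[OF manifold vbundle]] .
    with True show ?thesis by (simp add: anchor_act_def)
  next
    case False
    then have "\<delta> x = 0"
      using defect[OF X] defect[OF Y] defect[OF bracket_closed[OF X Y]] by auto
    then show ?thesis by (simp add: \<delta>_def)
  qed
qed

lemma left_anchor_scaleR:
  assumes "Y \<in> S" "w \<in> fibre E x"
  shows "left_anchor L x (Y x) \<xi> (r *\<^sub>R w) = r *\<^sub>R left_anchor L x (Y x) \<xi> w"
proof -
  let ?P = "\<lambda>B. B \<xi> (r *\<^sub>R w) = r *\<^sub>R B \<xi> w"
  have rw: "r *\<^sub>R w \<in> fibre E x"
    using assms(2) subspace_scale[OF subspace_fibre[OF manifold vbundle]] by blast
  have "left_anchor L x (Y x) \<in>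
      span {tensor_end M E x v A | v A. v \<in> tangent_space M x \<and> A \<in> endo E x}"
    using left_anchor_morphism assms(1) section_in_fibre[of Y M E]
    by (auto simp: bundle_morphism_def tangent_end_bundle_def linear_between_def)
  moreover have "subspace (Collect ?P)"
    by (auto simp: subspace_def algebra_simps)
  moreover have "?P (tensor_end M E x v A)" if "A \<in> endo E x" for v A
    using that assms(2) rw by (simp add: tensor_end_def endo_def linear_between_def)
  ultimately show ?thesis
    using span_induct[of "left_anchor L x (Y x)" _ ?P] by blast
qed

lemma act_order_section:
  assumes "f \<in> C" shows "diff_order_less C S C 1 (\<lambda>X. act X f)"
  by (rule diff_order_less_function_linear[OF module_sections module_functions
        act_linear_section[OF assms]]) (rule act_fmul)

lemma act_order_function:
  assumes "X \<in> S" shows "diff_order_less C C C 2 (act X)"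
proof -
  have "diff_order_less C C C 1 (mult_commutator f (act X))" if f: "f \<in> C" for f
  proof (rule diff_order_less_function_linear[OF module_functions module_functions])
    show "linear_between C C (mult_commutator f (act X))"
      by (intro linear_between_mult_commutator[OF module_functions module_functions f]
          act_linear_function[OF assms])
    have "mult_commutator f (act X) g = act X f * g" if "g \<in> C" for g
      using act_times[OF assms f that] by (simp add: mult_commutator_def fmul_eq_times)
    then show "mult_commutator f (act X) (g \<odot> h) = g \<odot> mult_commutator f (act X) h"
      if "g \<in> C" "h \<in> C" for g h
      using that function_moduleD(5)[OF module_functions]
      by (simp add: fmul_eq_times mult.left_commute)
  qed
  then show ?thesis
    using act_linear_function[OF assms] by (simp add: numeral_2_eq_2)
qed

lemma bracket_order_right:
  assumes "X \<in> S" shows "diff_order_less C S S 2 (\<lambda>Y. br X Y)"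
proof -
  have "diff_order_less C S S 1 (mult_commutator f (\<lambda>Y. br X Y))" if f: "f \<in> C" for f
  proof (rule diff_order_less_function_linear[OF module_sections module_sections])
    show "linear_between S S (mult_commutator f (\<lambda>Y. br X Y))"
      by (intro linear_between_mult_commutator[OF module_sections module_sections f]
          bracket_linear_right[OF assms])
    have "mult_commutator f (\<lambda>Y. br X Y) Y = act X f \<odot> Y" if "Y \<in> S" for Y
      using bracket_fmul_right[OF assms that f] by (simp add: mult_commutator_def)
    then show "mult_commutator f (\<lambda>Y. br X Y) (g \<odot> Y) = g \<odot> mult_commutator f (\<lambda>Y. br X Y) Y"
      if "g \<in> C" "Y \<in> S" for g Y
      using that function_moduleD(5)[OF module_sections]
      by (simp add: fun_eq_iff fmul_apply mult.commute)
  qed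
  then show ?thesis
    using bracket_linear_right[OF assms] by (simp add: numeral_2_eq_2)
qed

text \<open>Here the left anchor enters: it is what makes the bracket first order in its first argument
  as well.\<close>

lemma bracket_order_left:
  assumes "Y \<in> S" shows "diff_order_less C S S 2 (\<lambda>X. br X Y)"
proof -
  have "diff_order_less C S S 1 (mult_commutator f (\<lambda>X. br X Y))" if f: "f \<in> C" for f
  proof (rule diff_order_less_function_linear[OF module_sections module_sections])
    show "linear_between S S (mult_commutator f (\<lambda>X. br X Y))"
      by (intro linear_between_mult_commutator[OF module_sections module_sections f]
          bracket_linear_left[OF assms])
    have comm: "mult_commutator f (\<lambda>X. br X Y) X = left_anchor_act M L Y f X - act Y f \<odot> X"
      if "X \<in> S" for X
      using bracket_fmul_left[OF that assms f] by (simp add: mult_commutator_def)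
    have left_linear: "left_anchor_act M L Y f (g \<odot> X) = g \<odot> left_anchor_act M L Y f X" if "X \<in> S" for g X
      using left_anchor_scaleR[OF assms section_in_fibre[OF that]]
      by (simp add: left_anchor_act_def fun_eq_iff fmul_apply)
    then show "mult_commutator f (\<lambda>X. br X Y) (g \<odot> X) = g \<odot> mult_commutator f (\<lambda>X. br X Y) X"
      if "g \<in> C" "X \<in> S" for g X
    proof -
      have gX: "g \<odot> X \<in> S" using that function_moduleD(5)[OF module_sections] by blast
      have "act Y f \<odot> (g \<odot> X) = g \<odot> (act Y f \<odot> X)"
        by (simp add: fun_eq_iff fmul_apply mult.commute)
      then show ?thesis
        unfolding comm[OF gX] comm[OF that(2)] using left_linear[OF that(2)]
        by (simp only: fmul_simps)
    qed
  qed
  then show ?thesis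
    using bracket_linear_left[OF assms] by (simp add: numeral_2_eq_2)
qed

section \<open>Cochains\<close>

text \<open>Domains for the inductions on the number of arguments.  Unlike a single space of
  multidifferential operators, \<open>cochains\<close> contains operators of mixed degree and is stable under
  \<open>\<partial>\<close>, contractions and shuffle products, while \<open>multilinear_cochains\<close> is stable under contraction
  and supports the Jacobi identity inside an argument.  The vanishing on other lists turns
  identities on lists of sections into equalities of functions.\<close>

definition cochains :: "('m, 'v) oper set" where
  "cochains = {c. (\<forall>Xs. \<not> set Xs \<subseteq> S \<longrightarrow> c Xs = 0) \<and> (\<forall>Xs. set Xs \<subseteq> S \<longrightarrow> c Xs \<in> C)}"

definition multilinear_cochains :: "('m, 'v) oper set" where
  "multilinear_cochains = {c \<in> cochains. \<forall>Xs i. set Xs \<subseteq> S \<and> i < length Xs \<longrightarrow>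
     linear_between S C (\<lambda>X. c (Xs[i := X]))}"

lemma cochain_outside: "c \<in> cochains \<Longrightarrow> \<not> set Xs \<subseteq> S \<Longrightarrow> c Xs = 0"
  by (simp add: cochains_def)

lemma cochain_value: "c \<in> cochains \<Longrightarrow> set Xs \<subseteq> S \<Longrightarrow> c Xs \<in> C"
  by (simp add: cochains_def)

lemma multilinear_is_cochain: "c \<in> multilinear_cochains \<Longrightarrow> c \<in> cochains"
  by (simp add: multilinear_cochains_def)

lemma subspace_cochains: "subspace cochains"
  using function_moduleD[OF module_functions] by (auto simp: subspace_def cochains_def)

lemma subspace_multilinear_cochains: "subspace multilinear_cochains"
proof -
  have "linear_between S C (\<lambda>X. 0)"
    using function_moduleD[OF module_functions]
    by (simp add: linear_between_def del: zero_fun_apply)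
  moreover have "linear_between S C (\<lambda>X. a X + b X)" "linear_between S C (\<lambda>X. r *\<^sub>R a X)"
    if "linear_between S C a" "linear_between S C b" for a b r
    using that function_moduleD[OF module_functions]
    by (auto simp: linear_between_def scaleR_right_distrib)
  ultimately show ?thesis
    using subspace_cochains unfolding subspace_def multilinear_cochains_def
    by (simp only: mem_Collect_eq plus_fun_apply scaleR_fun_apply zero_fun_apply) blast
qed

lemma set_update_subset: "set Xs \<subseteq> A \<Longrightarrow> Y \<in> A \<Longrightarrow> set (Xs[i := Y]) \<subseteq> A"
  by (rule order_trans[OF set_update_subset_insert]) simp

lemma set_omit: "set Xs \<subseteq> A \<Longrightarrow> set (omit i Xs) \<subseteq> A"
  by (rule order_trans[OF set_omit_subset])

lemma update_bracket_closed:
  "set Xs \<subseteq> S \<Longrightarrow> X \<in> S \<Longrightarrow> j < length Xs \<Longrightarrow> set (Xs[j := br X (Xs ! j)]) \<subseteq> S"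
  using nth_mem[of j Xs] by (intro set_update_subset bracket_closed) auto

lemma contraction_cochain: "c \<in> cochains \<Longrightarrow> X \<in> S \<Longrightarrow> contraction X c \<in> cochains"
  by (simp add: cochains_def contraction_def)

lemma contraction_multilinear:
  assumes "c \<in> multilinear_cochains" "X \<in> S"
  shows "contraction X c \<in> multilinear_cochains"
proof -
  have "linear_between S C (\<lambda>Z. c (X # Xs[i := Z]))" if "set Xs \<subseteq> S" "i < length Xs" for Xs i
  proof -
    have "linear_between S C (\<lambda>Z. c ((X # Xs)[Suc i := Z]))"
      using assms(1)[unfolded multilinear_cochains_def, THEN CollectD, THEN conjunct2,
          rule_format, of "X # Xs" "Suc i"] assms(2) that by simp
    then show ?thesis by simp
  qed
  then show ?thesis
    using assms contraction_cochain by (simp add: multilinear_cochains_def contraction_def)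
qed

lemma coboundary_cochain:
  assumes c: "c \<in> cochains"
  shows "d c \<in> cochains"
proof -
  have "d c Xs \<in> C" if Xs: "set Xs \<subseteq> S" for Xs
  proof -
    have S: "Xs ! i \<in> S" if "i < length Xs" for i using Xs that nth_mem by blast
    have "act (Xs ! i) (c (omit i Xs)) \<in> C" if "i < length Xs" for i
      using S[OF that] Xs c by (intro act_closed cochain_value set_omit)
    moreover have "c (omit i (Xs[j := br (Xs ! i) (Xs ! j)])) \<in> C" if "j < length Xs" "i < j" for i j
      using S Xs c that by (intro cochain_value set_omit update_bracket_closed) auto
    ultimately show ?thesis
      using Xs subspace_smooth_funs[OF manifold]
      by (auto simp: coboundary_def intro!: subspace_add subspace_sum subspace_scale subspace_neg)
  qed
  then show ?thesis by (simp add: cochains_def coboundary_def)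
qed

lemma coboundary_add:
  assumes "a \<in> cochains" "b \<in> cochains"
  shows "d (a + b) = d a + d b"
proof
  fix Xs
  show "d (a + b) Xs = (d a + d b) Xs"
  proof (cases "set Xs \<subseteq> S")
    case True
    have "act (Xs ! i) (a (omit i Xs) + b (omit i Xs)) =
        act (Xs ! i) (a (omit i Xs)) + act (Xs ! i) (b (omit i Xs))" if "i < length Xs" for i
      using nth_mem[OF that] True by (intro act_add cochain_value assms set_omit) auto
    with True show ?thesis
      by (simp add: coboundary_def scaleR_right_distrib sum.distrib sum_subtractf sum_negf)
  qed (simp add: coboundary_def)
qed

lemma coboundary_scaleR:
  assumes "a \<in> cochains"
  shows "d (r *\<^sub>R a) = r *\<^sub>R d a"
proof
  fix Xs
  show "d (r *\<^sub>R a) Xs = (r *\<^sub>R d a) Xs"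
  proof (cases "set Xs \<subseteq> S")
    case True
    have "act (Xs ! i) (r *\<^sub>R a (omit i Xs)) = r *\<^sub>R act (Xs ! i) (a (omit i Xs))"
      if "i < length Xs" for i
      using nth_mem[OF that] True by (intro act_scaleR cochain_value assms set_omit) auto
    with True show ?thesis
      by (simp add: coboundary_def scaleR_right_distrib scaleR_sum_right mult.commute)
  qed (simp add: coboundary_def)
qed

lemma coboundary_Nil: "d c [] = 0"
  by (simp add: coboundary_def)

section \<open>Cartan calculus\<close>

lemma lie_eq: "lie X c = d (contraction X c) + contraction X (d c)"
  by (simp add: lie_derivative_def supercomm_def)

text \<open>In \<open>\<partial>c\<close> on \<open>X, X\<^sub>1, \<dots>, X\<^sub>n\<close> the terms in which \<open>X\<close> acts or is bracketed form the right-hand side;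
  in all others \<open>X\<close> stays in front and indices move by one, so that they add up to \<open>-\<partial>(i\<^sub>X c)\<close>.\<close>

lemma lie_apply:
  assumes X: "X \<in> S" and Xs: "set Xs \<subseteq> S"
  shows "lie X c Xs = act X (c Xs) - (\<Sum>i<length Xs. c (Xs[i := br X (Xs ! i)]))"
proof -
  have "d c (X # Xs) = act X (c Xs) - (\<Sum>i<length Xs. c (Xs[i := br X (Xs ! i)])) -
      d (contraction X c) Xs"
    using assms
    by (simp add: coboundary_def contraction_def sum.lessThan_Suc_shift omit_Cons
        sum_negf sum.distrib sum_subtractf del: sum.lessThan_Suc)
  then show ?thesis by (simp add: lie_eq contraction_def)
qed

lemma lie_outside: "c \<in> cochains \<Longrightarrow> \<not> set Xs \<subseteq> S \<Longrightarrow> lie X c Xs = 0"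
  by (simp add: lie_eq contraction_def coboundary_def)

lemma lie_cochain:
  assumes "c \<in> cochains" "X \<in> S"
  shows "lie X c \<in> cochains"
  unfolding lie_eq
  using assms by (intro subspace_add[OF subspace_cochains] contraction_cochain coboundary_cochain)

lemma contraction_simps:
  "contraction X (a + b) = contraction X a + contraction X b"
  "contraction X (a - b) = contraction X a - contraction X b"
  "contraction X (r *\<^sub>R a) = r *\<^sub>R contraction X a"
  by (simp_all add: contraction_def fun_eq_iff)

lemma lie_add:
  assumes "a \<in> cochains" "b \<in> cochains" "X \<in> S"
  shows "lie X (a + b) = lie X a + lie X b"
  using assms by (simp only: lie_eq contraction_simps coboundary_add contraction_cochain) simp

lemma lie_scaleR:
  assumes "a \<in> cochains" "X \<in> S"
  shows "lie X (r *\<^sub>R a) = r *\<^sub>R lie X a"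
  using assms
  by (simp only: lie_eq contraction_simps coboundary_scaleR contraction_cochain scaleR_right_distrib)

lemma coboundary_diff:
  assumes "a \<in> cochains" "b \<in> cochains"
  shows "d (a - b) = d a - d b"
  using coboundary_add[OF assms(1) subspace_scale[OF subspace_cochains assms(2), of "- 1"]]
    coboundary_scaleR[OF assms(2), of "- 1"] by simp

lemma lie_diff:
  assumes "a \<in> cochains" "b \<in> cochains" "X \<in> S"
  shows "lie X (a - b) = lie X a - lie X b"
  using lie_add[OF assms(1) subspace_scale[OF subspace_cochains assms(2), of "- 1"] assms(3)]
    lie_scaleR[OF assms(2,3), of "- 1"] by simp

lemma coboundary_zero: "d 0 = 0"
  using coboundary_scaleR[OF subspace_0[OF subspace_cochains], of 0] by simp

lemma contraction_coboundary: "contraction X (d c) = lie X c - d (contraction X c)"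
  by (simp add: lie_eq)

text \<open>The summand of \<open>L\<^sub>X c\<close> on \<open>Y, X\<^sub>1, \<dots>, X\<^sub>n\<close> that brackets \<open>X\<close> with \<open>Y\<close> is the only one missing from
  \<open>L\<^sub>X (i\<^sub>Y c)\<close>.\<close>

lemma lie_contraction_commutator:
  assumes c: "c \<in> cochains" and X: "X \<in> S" and Y: "Y \<in> S"
  shows "lie X (contraction Y c) - contraction Y (lie X c) = contraction (br X Y) c"
proof
  fix Xs
  show "(lie X (contraction Y c) - contraction Y (lie X c)) Xs = contraction (br X Y) c Xs"
  proof (cases "set Xs \<subseteq> S")
    case True
    then have "lie X c (Y # Xs) = lie X (contraction Y c) Xs - c (br X Y # Xs)"
      using X Y by (simp add: lie_apply sum.lessThan_Suc_shift contraction_def del: sum.lessThan_Suc)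
    then show ?thesis by (simp add: contraction_def)
  next
    case False
    then show ?thesis
      using c lie_outside[OF contraction_cochain[OF c Y]] lie_outside[OF c]
      by (simp add: contraction_def cochain_outside zero_fun_def)
  qed
qed

lemma contraction_lie:
  "c \<in> cochains \<Longrightarrow> X \<in> S \<Longrightarrow> Y \<in> S \<Longrightarrow>
    contraction Y (lie X c) = lie X (contraction Y c) - contraction (br X Y) c"
  using lie_contraction_commutator[of c X Y] by (simp add: algebra_simps)

lemma contraction_add_section:
  assumes c: "c \<in> multilinear_cochains" and X: "X \<in> S" and Y: "Y \<in> S"
  shows "contraction (X + Y) c = contraction X c + contraction Y c"
proof
  fix Xs
  show "contraction (X + Y) c Xs = (contraction X c + contraction Y c) Xs"
  proof (cases "set Xs \<subseteq> S")
    case True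
    then have "linear_between S C (\<lambda>Z. c ((X # Xs)[0 := Z]))"
      using c[unfolded multilinear_cochains_def, THEN CollectD, THEN conjunct2,
          rule_format, of "X # Xs" 0] X by simp
    from linear_betweenD(2)[OF this X Y] show ?thesis by (simp add: contraction_def)
  next
    case False
    then show ?thesis
      using multilinear_is_cochain[OF c] by (simp add: contraction_def cochain_outside zero_fun_def)
  qed
qed

text \<open>Commuting \<open>i\<^sub>Z\<close> through both sides leaves \<open>i\<^sub>[\<^sub>X\<^sub>,\<^sub>[\<^sub>Y\<^sub>,\<^sub>Z\<^sub>]\<^sub>] - i\<^sub>[\<^sub>Y\<^sub>,\<^sub>[\<^sub>X\<^sub>,\<^sub>Z\<^sub>]\<^sub>]\<close> on the left and
  \<open>i\<^sub>[\<^sub>[\<^sub>X\<^sub>,\<^sub>Y\<^sub>]\<^sub>,\<^sub>Z\<^sub>]\<close> on the right.  These agree by the Jacobi identity, since \<open>c\<close> is additive in its first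
  argument.\<close>

lemma lie_commutator:
  assumes c: "c \<in> multilinear_cochains" and X: "X \<in> S" and Y: "Y \<in> S"
  shows "lie X (lie Y c) - lie Y (lie X c) = lie (br X Y) c"
proof
  fix Xs
  note XY = bracket_closed[OF X Y]
  show "(lie X (lie Y c) - lie Y (lie X c)) Xs = lie (br X Y) c Xs"
    using c
  proof (induction Xs arbitrary: c)
    case Nil
    have "c [] \<in> C" using cochain_value[OF multilinear_is_cochain[OF Nil]] by simp
    then show ?case
      using act_bracket[OF X Y] X Y XY by (simp add: lie_apply)
  next
    case (Cons Z Xs)
    note c = multilinear_is_cochain[OF Cons.prems]
    show ?case
    proof (cases "Z \<in> S")
      case Z: True
      let ?c = "contraction Z c"
      note cc = contraction_cochain[OF c Z]
      have expand: "contraction Z (lie A (lie B c)) =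
          lie A (lie B ?c) - lie A (contraction (br B Z) c) - lie B (contraction (br A Z) c) +
          contraction (br B (br A Z)) c" if A: "A \<in> S" and B: "B \<in> S" for A B
        using A B Z c cc
        by (simp only: contraction_lie lie_cochain contraction_cochain bracket_closed lie_diff) simp
      have "contraction (br X (br Y Z)) c =
          contraction (br (br X Y) Z) c + contraction (br Y (br X Z)) c"
        unfolding jacobi[OF X Y Z]
        by (intro contraction_add_section Cons.prems bracket_closed X Y Z)
      then have "contraction Z (lie X (lie Y c) - lie Y (lie X c)) =
          (lie X (lie Y ?c) - lie Y (lie X ?c)) - contraction (br (br X Y) Z) c"
        unfolding contraction_simps expand[OF X Y] expand[OF Y X] by simp
      moreover have "(lie X (lie Y ?c) - lie Y (lie X ?c)) Xs = lie (br X Y) ?c Xs"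
        using Cons.IH contraction_multilinear[OF Cons.prems Z] .
      ultimately have "contraction Z (lie X (lie Y c) - lie Y (lie X c)) Xs =
          contraction Z (lie (br X Y) c) Xs"
        unfolding contraction_lie[OF c XY Z] by simp
      then show ?thesis by (simp add: contraction_def)
    next
      case False
      then show ?thesis using c X Y by (simp add: lie_outside lie_cochain)
    qed
  qed
qed

text \<open>Contracting \<open>[\<partial>, L\<^sub>X] c\<close> with \<open>Z\<close> gives \<open>[L\<^sub>Z, L\<^sub>X] c + L\<^sub>[\<^sub>X\<^sub>,\<^sub>Z\<^sub>] c = 0\<close> and the same commutator, up to
  sign, on \<open>i\<^sub>Z c\<close>.\<close>

lemma coboundary_lie:
  assumes c: "c \<in> multilinear_cochains" and X: "X \<in> S"
  shows "d (lie X c) = lie X (d c)"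
proof
  fix Xs
  show "d (lie X c) Xs = lie X (d c) Xs"
    using c
  proof (induction Xs arbitrary: c)
    case Nil
    then show ?case using X act_0 by (simp add: lie_apply coboundary_Nil)
  next
    case (Cons Z Xs)
    note c = multilinear_is_cochain[OF Cons.prems]
    show ?case
    proof (cases "Z \<in> S")
      case Z: True
      note XZ = bracket_closed[OF X Z]
      let ?c = "contraction Z c"
      note cc = contraction_cochain[OF c Z]
      have "contraction Z (d (lie X c)) = lie Z (lie X c) - d (lie X ?c) + d (contraction (br X Z) c)"
        using c cc X Z XZ
        by (simp only: contraction_coboundary contraction_lie coboundary_diff lie_cochain
            contraction_cochain) simp
      moreover have "contraction Z (lie X (d c)) =
          lie X (lie Z c) - lie X (d ?c) - lie (br X Z) c + d (contraction (br X Z) c)"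
        using c cc X Z XZ
        by (simp only: contraction_coboundary contraction_lie lie_diff lie_cochain
            coboundary_cochain contraction_cochain) simp
      moreover have "lie X (lie Z c) - lie (br X Z) c = lie Z (lie X c)"
        using lie_commutator[OF Cons.prems X Z] by (simp add: algebra_simps)
      ultimately have "contraction Z (d (lie X c)) =
          contraction Z (lie X (d c)) + (lie X (d ?c) - d (lie X ?c))"
        by (simp only:) (simp add: algebra_simps)
      moreover have "d (lie X ?c) Xs = lie X (d ?c) Xs"
        using Cons.IH contraction_multilinear[OF Cons.prems Z] .
      ultimately have "contraction Z (d (lie X c)) Xs = contraction Z (lie X (d c)) Xs"
        by (simp add: fun_eq_iff)
      then show ?thesis by (simp add: contraction_def)
    next
      case False
      then show ?thesis
        using c X by (simp add: lie_outside coboundary_cochain) (simp add: coboundary_def)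
    qed
  qed
qed

text \<open>\<open>i\<^sub>Z \<partial>\<^sup>2 = (L\<^sub>Z - \<partial> i\<^sub>Z) \<partial> = L\<^sub>Z \<partial> - \<partial> (L\<^sub>Z - \<partial> i\<^sub>Z) = \<partial>\<^sup>2 i\<^sub>Z\<close>, because \<open>\<partial>\<close> and \<open>L\<^sub>Z\<close> commute.\<close>

lemma coboundary_coboundary:
  assumes c: "c \<in> multilinear_cochains"
  shows "d (d c) = 0"
proof
  fix Xs
  show "d (d c) Xs = 0 Xs"
    using c
  proof (induction Xs arbitrary: c)
    case Nil
    then show ?case by (simp add: coboundary_Nil)
  next
    case (Cons Z Xs)
    note c = multilinear_is_cochain[OF Cons.prems]
    show ?case
    proof (cases "Z \<in> S")
      case Z: True
      have "contraction Z (d (d c)) = d (d (contraction Z c))"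
        using c Z coboundary_lie[OF Cons.prems Z]
        by (simp only: contraction_coboundary coboundary_diff lie_cochain coboundary_cochain
            contraction_cochain) simp
      moreover have "d (d (contraction Z c)) Xs = 0 Xs"
        using Cons.IH contraction_multilinear[OF Cons.prems Z] .
      ultimately show ?thesis by (simp add: contraction_def fun_eq_iff)
    next
      case False
      then show ?thesis by (simp add: coboundary_def)
    qed
  qed
qed

section \<open>The Leibniz rule for the shuffle product\<close>

lemma degree_sign_cochain: "c \<in> cochains \<Longrightarrow> degree_sign c \<in> cochains"
  using subspace_scale[OF subspace_smooth_funs[OF manifold]]
  by (simp add: cochains_def degree_sign_def del: scaleR_fun_apply)

lemma lie_degree_sign:
  assumes c: "c \<in> cochains" and X: "X \<in> S"
  shows "lie X (degree_sign c) = degree_sign (lie X c)"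
proof
  fix Xs
  show "lie X (degree_sign c) Xs = degree_sign (lie X c) Xs"
  proof (cases "set Xs \<subseteq> S")
    case True
    then show ?thesis
      using act_scaleR[OF X cochain_value[OF c True]] X
      by (simp add: lie_apply degree_sign_def scaleR_diff_right scaleR_sum_right)
  next
    case False
    then show ?thesis
      using lie_outside[OF degree_sign_cochain[OF c]] lie_outside[OF c]
      by (simp add: degree_sign_def del: scaleR_fun_apply)
  qed
qed

lemma coboundary_degree_sign:
  assumes "c \<in> cochains"
  shows "d (degree_sign c) = - degree_sign (d c)"
proof
  fix Xs
  show "d (degree_sign c) Xs = (- degree_sign (d c)) Xs"
    using assms
  proof (induction Xs arbitrary: c)
    case Nil
    then show ?case by (simp add: coboundary_Nil degree_sign_def)
  next
    case (Cons Z Xs)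
    show ?case
    proof (cases "Z \<in> S")
      case Z: True
      note cc = contraction_cochain[OF Cons.prems Z]
      have "contraction Z (d (degree_sign c)) =
          degree_sign (lie Z c) + d (degree_sign (contraction Z c))"
        using coboundary_scaleR[OF degree_sign_cochain[OF cc], of "- 1"]
        by (simp add: contraction_coboundary lie_degree_sign Cons.prems Z contraction_degree_sign)
      moreover have "d (degree_sign (contraction Z c)) Xs = (- degree_sign (d (contraction Z c))) Xs"
        using Cons.IH[OF cc] .
      moreover have "contraction Z (- degree_sign (d c)) =
          degree_sign (lie Z c) - degree_sign (d (contraction Z c))"
        using contraction_degree_sign[of Z "d c"] contraction_simps(3)[of Z "- 1" "degree_sign (d c)"]
        by (simp add: contraction_coboundary degree_sign_diff)
      ultimately have "contraction Z (d (degree_sign c)) Xs = contraction Z (- degree_sign (d c)) Xs"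
        by (simp add: fun_eq_iff)
      then show ?thesis by (simp add: contraction_def)
    next
      case False
      then show ?thesis by (simp add: coboundary_def degree_sign_def zero_fun_def)
    qed
  qed
qed

lemma shuffle_prod_value:
  assumes "a \<in> cochains" "b \<in> cochains"
  shows "if set Xs \<subseteq> S then shuffle_prod a b Xs \<in> C else shuffle_prod a b Xs = 0"
  using assms
proof (induction Xs arbitrary: a b)
  case Nil
  then show ?case
    using cochain_value[of a "[]"] cochain_value[of b "[]"] smooth_funs_mult[OF manifold]
    by (simp add: shuffle_prod_Nil)
next
  case (Cons X Xs)
  show ?case
  proof (cases "X \<in> S")
    case True
    note ab = contraction_cochain[OF Cons.prems(1) True] contraction_cochain[OF Cons.prems(2) True]
    note IH = Cons.IH[OF ab(1) Cons.prems(2)]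
      Cons.IH[OF degree_sign_cochain[OF Cons.prems(1)] ab(2)]
    show ?thesis
    proof (cases "set Xs \<subseteq> S")
      case Xs: True
      with IH have "shuffle_prod a b (X # Xs) \<in> C"
        unfolding shuffle_prod_Cons by (intro subspace_add[OF subspace_smooth_funs[OF manifold]]) simp_all
      with True Xs show ?thesis by simp
    next
      case False
      with IH show ?thesis by (simp add: shuffle_prod_Cons zero_fun_def)
    qed
  next
    case False
    then have "contraction X a = 0" "contraction X b = 0"
      using Cons.prems by (auto simp: contraction_def cochain_outside fun_eq_iff)
    with False show ?thesis by (simp add: shuffle_prod_Cons shuffle_prod_zero)
  qed
qed

lemma shuffle_prod_cochain: "a \<in> cochains \<Longrightarrow> b \<in> cochains \<Longrightarrow> shuffle_prod a b \<in> cochains"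
  using shuffle_prod_value[of a b] unfolding cochains_def mem_Collect_eq by metis

text \<open>Both sides obey the same recursion: \<open>i\<^sub>Z\<close> commutes with \<open>L\<^sub>X\<close> up to \<open>i\<^sub>[\<^sub>X\<^sub>,\<^sub>Z\<^sub>]\<close>, and the contractions
  with \<open>Z\<close> and with \<open>[X,Z]\<close> satisfy the same Leibniz rule.  On the empty list this is the product
  rule for the anchor.\<close>

lemma lie_shuffle_prod:
  assumes "a \<in> cochains" "b \<in> cochains" and X: "X \<in> S"
  shows "lie X (shuffle_prod a b) = shuffle_prod (lie X a) b + shuffle_prod a (lie X b)"
proof
  fix Xs
  show "lie X (shuffle_prod a b) Xs = (shuffle_prod (lie X a) b + shuffle_prod a (lie X b)) Xs"
    using assms(1,2)
  proof (induction Xs arbitrary: a b)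
    case Nil
    then show ?case
      using X act_times[OF X cochain_value[of a "[]"] cochain_value[of b "[]"]]
      by (simp add: lie_apply shuffle_prod_Nil)
  next
    case (Cons Z Xs)
    note a = Cons.prems(1) and b = Cons.prems(2)
    show ?case
    proof (cases "Z \<in> S")
      case Z: True
      note XZ = bracket_closed[OF X Z]
      note a' = degree_sign_cochain[OF a]
      note za = contraction_cochain[OF a Z] and zb = contraction_cochain[OF b Z]
      have "contraction Z (lie X (shuffle_prod a b)) =
          lie X (shuffle_prod (contraction Z a) b) + lie X (shuffle_prod (degree_sign a) (contraction Z b)) -
          (shuffle_prod (contraction (br X Z) a) b + shuffle_prod (degree_sign a) (contraction (br X Z) b))"
        using a b X Z XZ a' za zb
        by (simp only: contraction_lie shuffle_prod_cochain contraction_shuffle_prod lie_add)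
      moreover have "contraction Z (shuffle_prod (lie X a) b + shuffle_prod a (lie X b)) =
          shuffle_prod (lie X (contraction Z a)) b - shuffle_prod (contraction (br X Z) a) b +
          shuffle_prod (lie X (degree_sign a)) (contraction Z b) +
          (shuffle_prod (contraction Z a) (lie X b) +
           shuffle_prod (degree_sign a) (lie X (contraction Z b)) -
           shuffle_prod (degree_sign a) (contraction (br X Z) b))"
        using a b X Z
        by (simp only: contraction_simps contraction_lie contraction_shuffle_prod
            lie_degree_sign shuffle_prod_diff) (simp add: algebra_simps)
      ultimately have "contraction Z (lie X (shuffle_prod a b)) Xs =
          contraction Z (shuffle_prod (lie X a) b + shuffle_prod a (lie X b)) Xs"
        using Cons.IH[OF za b] Cons.IH[OF a' zb] 
        by (simp only: plus_fun_apply minus_apply) (simp add: fun_eq_iff)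
      then show ?thesis by (simp only: contraction_def)
    next
      case False
      then have "\<not> set (Z # Xs) \<subseteq> S" by simp
      then show ?thesis
        using a b X cochain_outside[OF lie_cochain[OF shuffle_prod_cochain[OF a b] X]]
          cochain_outside[OF shuffle_prod_cochain[OF lie_cochain[OF a X] b]]
          cochain_outside[OF shuffle_prod_cochain[OF a lie_cochain[OF b X]]]
        by (simp only: plus_fun_apply) simp
    qed
  qed
qed

text \<open>Here the recursion is \<open>i\<^sub>Z \<partial> = L\<^sub>Z - \<partial> i\<^sub>Z\<close> with the Leibniz rule for \<open>L\<^sub>Z\<close>.\<close>

lemma coboundary_shuffle_prod:
  assumes "a \<in> cochains" "b \<in> cochains"
  shows "d (shuffle_prod a b) = shuffle_prod (d a) b + shuffle_prod (degree_sign a) (d b)"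
proof
  fix Xs
  show "d (shuffle_prod a b) Xs = (shuffle_prod (d a) b + shuffle_prod (degree_sign a) (d b)) Xs"
    using assms
  proof (induction Xs arbitrary: a b)
    case Nil
    then show ?case by (simp add: coboundary_Nil shuffle_prod_Nil)
  next
    case (Cons Z Xs)
    note a = Cons.prems(1) and b = Cons.prems(2)
    show ?case
    proof (cases "Z \<in> S")
      case Z: True
      note a' = degree_sign_cochain[OF a]
      note za = contraction_cochain[OF a Z] and zb = contraction_cochain[OF b Z]
      have "contraction Z (d (shuffle_prod a b)) =
          shuffle_prod (lie Z a) b + shuffle_prod a (lie Z b) -
          (d (shuffle_prod (contraction Z a) b) + d (shuffle_prod (degree_sign a) (contraction Z b)))"
        using a b Z a' za zb
        by (simp only: contraction_coboundary shuffle_prod_cochain contraction_shuffle_prod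
            coboundary_add lie_shuffle_prod)
      moreover have "contraction Z (shuffle_prod (d a) b + shuffle_prod (degree_sign a) (d b)) =
          shuffle_prod (lie Z a) b - shuffle_prod (d (contraction Z a)) b -
          shuffle_prod (d (degree_sign a)) (contraction Z b) -
          shuffle_prod (degree_sign (contraction Z a)) (d b) +
          (shuffle_prod a (lie Z b) - shuffle_prod a (d (contraction Z b)))"
        using a b Z
        by (simp only: contraction_simps contraction_coboundary contraction_shuffle_prod
            coboundary_degree_sign contraction_degree_sign shuffle_prod_diff shuffle_prod_minus
            degree_sign_degree_sign) (simp add: algebra_simps)
      ultimately have "contraction Z (d (shuffle_prod a b)) Xs =
          contraction Z (shuffle_prod (d a) b + shuffle_prod (degree_sign a) (d b)) Xs"
        using Cons.IH[OF za b] Cons.IH[OF a' zb]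
        by (simp only: plus_fun_apply minus_apply degree_sign_degree_sign) (simp add: fun_eq_iff)
      then show ?thesis by (simp only: contraction_def)
    next
      case False
      then have "\<not> set (Z # Xs) \<subseteq> S" by simp
      then show ?thesis
        using cochain_outside[OF coboundary_cochain[OF shuffle_prod_cochain[OF a b]]]
          cochain_outside[OF shuffle_prod_cochain[OF coboundary_cochain[OF a] b]]
          cochain_outside[OF shuffle_prod_cochain[OF degree_sign_cochain[OF a] coboundary_cochain[OF b]]]
        by (simp only: plus_fun_apply) simp
    qed
  qed
qed

section \<open>Multidifferential operators are preserved\<close>

lemma diff_opsI:
  assumes c: "c \<in> cochains"
    and arity: "\<And>Xs. length Xs \<noteq> p \<Longrightarrow> c Xs = 0"
    and order: "\<And>i Xs. i < p \<Longrightarrow> length Xs = p \<Longrightarrow> set Xs \<subseteq> S \<Longrightarrow>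
      diff_order_less C S C k (\<lambda>X. c (Xs[i := X]))"
  shows "c \<in> diff_ops M E p"
proof -
  have lin: "linear_between S C (\<lambda>X. c (Xs[i := X]))"
    if "i < p" "length Xs = p" "set Xs \<subseteq> S" for i Xs
    using diff_order_less_linear[OF order[OF that]] .
  have van: "foldr (slot_comm i) fs c Xs = 0"
    if "i < p" "length fs = Suc k" "set fs \<subseteq> C" "length Xs = p" "set Xs \<subseteq> S" for i fs Xs
  proof -
    have "diff_order_less C S C (Suc k) (\<lambda>X. c (Xs[i := X]))"
      by (rule diff_order_less_mono[OF module_sections module_functions order[OF that(1,4,5)]]) simp
    then have "foldr mult_commutator fs (\<lambda>X. c (Xs[i := X])) (Xs ! i) = 0"
      unfolding diff_order_less_iff_foldr[OF module_sections module_functions]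
      using that nth_mem[of i Xs] by blast
    then show ?thesis
      using foldr_slot_comm[of i Xs fs c "Xs ! i"] that by simp
  qed
  show ?thesis
    unfolding diff_ops_def mem_Collect_eq
  proof (intro conjI)
    show "\<forall>Xs. \<not> (length Xs = p \<and> set Xs \<subseteq> S) \<longrightarrow> c Xs = 0"
      using arity cochain_outside[OF c] by blast
    show "\<forall>Xs. length Xs = p \<and> set Xs \<subseteq> S \<longrightarrow> c Xs \<in> C"
      using cochain_value[OF c] by blast
    show "\<forall>Xs. \<forall>i<p. length Xs = p \<and> set Xs \<subseteq> S \<longrightarrow> linear_between S C (\<lambda>X. c (Xs[i := X]))"
      using lin by blast
    show "\<exists>k. \<forall>i<p. \<forall>fs Xs. length fs = Suc k \<and> set fs \<subseteq> C \<and> length Xs = p \<and> set Xs \<subseteq> S \<longrightarrow>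
        foldr (slot_comm i) fs c Xs = 0"
      using van by blast
  qed
qed

lemma diff_ops_arity: "c \<in> diff_ops M E p \<Longrightarrow> length Xs \<noteq> p \<Longrightarrow> c Xs = 0"
  by (simp add: diff_ops_def)

lemma diff_ops_cochain: "c \<in> diff_ops M E p \<Longrightarrow> c \<in> cochains"
  using function_moduleD(1)[OF module_functions] unfolding diff_ops_def cochains_def mem_Collect_eq
  by metis

lemma diff_ops_multilinear:
  assumes "c \<in> diff_ops M E p"
  shows "c \<in> multilinear_cochains"
proof -
  have "linear_between S C (\<lambda>X. c (Xs[i := X]))" if "set Xs \<subseteq> S" "i < length Xs" for Xs i
  proof (cases "length Xs = p")
    case True
    then show ?thesis using assms that by (simp add: diff_ops_def)
  next
    case False
    then have "c (Xs[i := X]) = 0" for X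
      by (intro diff_ops_arity[OF assms]) simp
    moreover have "linear_between S C (\<lambda>X. 0)"
      using diff_order_less_linear[OF diff_order_less_zero[OF module_sections module_functions]] .
    ultimately show ?thesis by simp
  qed
  then show ?thesis
    using diff_ops_cochain[OF assms] by (simp add: multilinear_cochains_def)
qed

lemma diff_ops_orderE:
  assumes c: "c \<in> diff_ops M E p"
  obtains k where "\<And>i Xs. i < p \<Longrightarrow> length Xs = p \<Longrightarrow> set Xs \<subseteq> S \<Longrightarrow>
    diff_order_less C S C k (\<lambda>X. c (Xs[i := X]))"
proof -
  from c have "\<exists>k. \<forall>i<p. \<forall>fs Xs.
      length fs = Suc k \<and> set fs \<subseteq> C \<and> length Xs = p \<and> set Xs \<subseteq> S \<longrightarrow>
      foldr (slot_comm i) fs c Xs = 0"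
    by (simp only: diff_ops_def mem_Collect_eq)
  then obtain k where k: "\<forall>i<p. \<forall>fs Xs.
      length fs = Suc k \<and> set fs \<subseteq> C \<and> length Xs = p \<and> set Xs \<subseteq> S \<longrightarrow>
      foldr (slot_comm i) fs c Xs = 0" ..
  have "diff_order_less C S C (Suc k) (\<lambda>X. c (Xs[i := X]))"
    if that: "i < p" "length Xs = p" "set Xs \<subseteq> S" for i Xs
    unfolding diff_order_less_iff_foldr[OF module_sections module_functions]
  proof (intro conjI allI impI)
    show "linear_between S C (\<lambda>X. c (Xs[i := X]))"
      using c that by (simp add: diff_ops_def)
    fix fs X assume fs: "length fs = Suc k \<and> set fs \<subseteq> C \<and> X \<in> S"
    have "foldr (slot_comm i) fs c (Xs[i := X]) = 0"
      using fs that set_update_subset[OF that(3), of X i] by (intro k[rule_format]) auto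
    then show "foldr mult_commutator fs (\<lambda>X. c (Xs[i := X])) X = 0"
      using foldr_slot_comm[of i Xs fs c X] that by simp
  qed
  then show thesis using that by blast
qed

lemma subspace_diff_ops: "subspace (diff_ops M E p)"
proof -
  have "0 \<in> diff_ops M E p"
    using subspace_0[OF subspace_cochains] diff_order_less_zero[OF module_sections module_functions]
    by (intro diff_opsI[where k = 0]) (simp_all only: zero_fun_apply)
  moreover have "a + b \<in> diff_ops M E p" if ab: "a \<in> diff_ops M E p" "b \<in> diff_ops M E p" for a b
  proof -
    obtain k where k: "\<And>i Xs. i < p \<Longrightarrow> length Xs = p \<Longrightarrow> set Xs \<subseteq> S \<Longrightarrow>
        diff_order_less C S C k (\<lambda>X. a (Xs[i := X]))"
      using diff_ops_orderE[OF ab(1)] by metis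
    obtain l where l: "\<And>i Xs. i < p \<Longrightarrow> length Xs = p \<Longrightarrow> set Xs \<subseteq> S \<Longrightarrow>
        diff_order_less C S C l (\<lambda>X. b (Xs[i := X]))"
      using diff_ops_orderE[OF ab(2)] by metis
    show ?thesis
    proof (rule diff_opsI[where k = "k + l"])
      show "a + b \<in> cochains"
        using ab by (intro subspace_add[OF subspace_cochains] diff_ops_cochain)
      show "(a + b) Xs = 0" if "length Xs \<noteq> p" for Xs
        using ab that by (simp add: diff_ops_arity zero_fun_def)
      show "diff_order_less C S C (k + l) (\<lambda>X. (a + b) (Xs[i := X]))"
        if "i < p" "length Xs = p" "set Xs \<subseteq> S" for i Xs
        unfolding plus_fun_apply[of a b]
        using k[OF that] l[OF that]
        by (intro diff_order_less_add[OF module_sections module_functions])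
          (auto intro: diff_order_less_mono[OF module_sections module_functions])
    qed
  qed
  moreover have "r *\<^sub>R a \<in> diff_ops M E p" if a: "a \<in> diff_ops M E p" for a r
  proof -
    obtain k where k: "\<And>i Xs. i < p \<Longrightarrow> length Xs = p \<Longrightarrow> set Xs \<subseteq> S \<Longrightarrow>
        diff_order_less C S C k (\<lambda>X. a (Xs[i := X]))"
      using diff_ops_orderE[OF a] by metis
    show ?thesis
    proof (rule diff_opsI[where k = k])
      show "r *\<^sub>R a \<in> cochains"
        using a by (intro subspace_scale[OF subspace_cochains] diff_ops_cochain)
      show "(r *\<^sub>R a) Xs = 0" if "length Xs \<noteq> p" for Xs
        using diff_ops_arity[OF a that] by (simp only: scaleR_fun_apply[of r a] scaleR_zero_right)
      show "diff_order_less C S C k (\<lambda>X. (r *\<^sub>R a) (Xs[i := X]))"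
        if "i < p" "length Xs = p" "set Xs \<subseteq> S" for i Xs
        unfolding scaleR_fun_apply[of r a]
        by (intro diff_order_less_scaleR[OF module_sections module_functions] k that)
    qed
  qed
  ultimately show ?thesis by (simp add: subspace_def)
qed

lemma contraction_diff_ops:
  assumes c: "c \<in> diff_ops M E (Suc p)" and X: "X \<in> S"
  shows "contraction X c \<in> diff_ops M E p"
proof -
  obtain k where k: "\<And>i Xs. i < Suc p \<Longrightarrow> length Xs = Suc p \<Longrightarrow> set Xs \<subseteq> S \<Longrightarrow>
      diff_order_less C S C k (\<lambda>X. c (Xs[i := X]))"
    using diff_ops_orderE[OF c] by metis
  show ?thesis
  proof (rule diff_opsI[where k = k])
    show "contraction X c \<in> cochains"
      using contraction_cochain[OF diff_ops_cochain[OF c] X] .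
    show "contraction X c Xs = 0" if "length Xs \<noteq> p" for Xs
      using diff_ops_arity[OF c, of "X # Xs"] that by (simp add: contraction_def)
    show "diff_order_less C S C k (\<lambda>Z. contraction X c (Xs[i := Z]))"
      if "i < p" "length Xs = p" "set Xs \<subseteq> S" for i Xs
      using k[of "Suc i" "X # Xs"] that X by (simp add: contraction_def)
  qed
qed

lemma contraction_diff_ops_0: "c \<in> diff_ops M E 0 \<Longrightarrow> contraction X c = 0"
  by (auto simp: contraction_def fun_eq_iff diff_ops_arity)

text \<open>As a function of a single argument, each term of \<open>\<partial>c\<close> is one of the following: the anchor of
  that argument applied to a fixed function; a fixed section acting on a value of \<open>c\<close>; a value of \<open>c\<close>
  on the bracket of that argument with a fixed section; a value of \<open>c\<close> on the argument itself.  All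
  have order at most one more than \<open>c\<close>.\<close>

lemma coboundary_diff_ops:
  assumes c: "c \<in> diff_ops M E p"
  shows "d c \<in> diff_ops M E (Suc p)"
proof -
  obtain k where k: "\<And>i Xs. i < p \<Longrightarrow> length Xs = p \<Longrightarrow> set Xs \<subseteq> S \<Longrightarrow>
      diff_order_less C S C k (\<lambda>X. c (Xs[i := X]))"
    using diff_ops_orderE[OF c] by metis
  note mono = diff_order_less_mono[OF module_sections module_functions]
  show ?thesis
  \<comment> \<open>The composition rule adds strict bounds, and 2 is the strict bound of a first-order operator.\<close>
  proof (rule diff_opsI[where k = "k + 2"])
    show "d c \<in> cochains" using coboundary_cochain[OF diff_ops_cochain[OF c]] .
  next
    fix Xs :: "('m \<Rightarrow> 'v) list" assume len: "length Xs \<noteq> Suc p"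
    show "d c Xs = 0"
    proof (cases "set Xs \<subseteq> S")
      case True
      have "act (Xs ! i) (c (omit i Xs)) = 0" if "i < length Xs" for i
        using diff_ops_arity[OF c, of "omit i Xs"] length_omit[OF that] len that
          act_0[of "Xs ! i"] subsetD[OF True nth_mem[OF that]] by simp
      moreover have "c (omit i (Xs[j := Y])) = 0" if "i < j" "j < length Xs" for i j Y
        using len that length_omit[of i "Xs[j := Y]"] by (intro diff_ops_arity[OF c]) simp
      ultimately show ?thesis by (simp add: coboundary_def)
    qed (simp add: coboundary_def)
  next
    fix l and Xs :: "('m \<Rightarrow> 'v) list"
    assume l: "l < Suc p" and len: "length Xs = Suc p" and Xs: "set Xs \<subseteq> S"
    have S: "Xs ! i \<in> S" if "i < Suc p" for i
      using nth_mem[of i Xs] Xs len that by auto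
    have slot: "diff_order_less C S C k (\<lambda>Z. c (Ys[m := Z]))"
      if "m < p" "length Ys = p" "set Ys \<subseteq> S" for m Ys using k that by blast
    have anchor_term: "diff_order_less C S C (k + 2)
        (\<lambda>Z. act (Xs[l := Z] ! i) (c (omit i (Xs[l := Z]))))" if i: "i < Suc p" for i
    proof (cases "i = l")
      case True
      have "c (omit l Xs) \<in> C"
        using cochain_value[OF diff_ops_cochain[OF c] set_omit[OF Xs]] .
      then have "diff_order_less C S C (k + 2) (\<lambda>Z. act Z (c (omit l Xs)))"
        by (intro mono[OF act_order_section]) simp_all
      then show ?thesis using True l len by (simp add: omit_update_same)
    next
      case False
      have "diff_order_less C S C (k + 2)
          (\<lambda>Z. act (Xs ! i) (c ((omit i Xs)[(if l < i then l else l - 1) := Z])))"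
        using False l i len Xs
        by (intro diff_order_less_comp[OF module_sections module_functions module_functions]
            act_order_function slot S set_omit) (auto simp: length_omit)
      then show ?thesis using False l len by (simp add: omit_update)
    qed
    have bracket_term: "diff_order_less C S C (k + 2)
        (\<lambda>Z. c (omit i ((Xs[l := Z])[j := br (Xs[l := Z] ! i) (Xs[l := Z] ! j)])))"
      if ij: "i < j" "j < Suc p" for i j
    proof -
      have omit_j: "omit i (Xs[j := V]) = (omit i Xs)[j - 1 := V]" for V
        using ij len by (simp add: omit_update)
      consider "l = i" | "l = j" | "l \<noteq> i" "l \<noteq> j" by blast
      then show ?thesis
      proof cases
        case 1
        have "diff_order_less C S C (2 + k) (\<lambda>Z. c ((omit i Xs)[j - 1 := br Z (Xs ! j)]))"
          using ij len Xs
          by (intro diff_order_less_comp[OF module_sections module_sections module_functions]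
              bracket_order_left slot S set_omit) (auto simp: length_omit)
        moreover have "omit i ((Xs[l := Z])[j := V]) = (omit i Xs)[j - 1 := V]" for Z V
          using 1 ij omit_j by (metis omit_update_same list_update_swap order_less_irrefl)
        ultimately show ?thesis
          using 1 ij len by (simp add: add.commute)
      next
        case 2
        have "diff_order_less C S C (2 + k) (\<lambda>Z. c ((omit i Xs)[j - 1 := br (Xs ! i) Z]))"
          using ij len Xs
          by (intro diff_order_less_comp[OF module_sections module_sections module_functions]
              bracket_order_right slot S set_omit) (auto simp: length_omit)
        then show ?thesis
          using 2 ij len omit_j by (simp add: add.commute)
      next
        case 3
        let ?Ys = "Xs[j := br (Xs ! i) (Xs ! j)]"
        have "set ?Ys \<subseteq> S"
          using ij len Xs S by (intro update_bracket_closed) auto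
        then have "diff_order_less C S C k (\<lambda>Z. c ((omit i ?Ys)[(if l < i then l else l - 1) := Z]))"
          using 3 l ij len by (intro slot set_omit) (auto simp: length_omit)
        moreover have "omit i ((Xs[l := Z])[j := br (Xs ! i) (Xs ! j)]) =
            (omit i ?Ys)[(if l < i then l else l - 1) := Z]" for Z
          using 3 l len omit_update[of l i ?Ys Z] by (simp add: list_update_swap[of l j])
        moreover have "Xs[l := Z] ! i = Xs ! i" "Xs[l := Z] ! j = Xs ! j" for Z
          using 3 by simp_all
        ultimately show ?thesis
          by (simp only: mono[OF _ le_add1])
      qed
    qed
    have "diff_order_less C S C (k + 2) (\<lambda>Z.
        (\<Sum>i<Suc p. (- 1) ^ i *\<^sub>R act (Xs[l := Z] ! i) (c (omit i (Xs[l := Z])))) +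
        (\<Sum>j<Suc p. \<Sum>i<j. (- 1) ^ Suc i *\<^sub>R
          c (omit i ((Xs[l := Z])[j := br (Xs[l := Z] ! i) (Xs[l := Z] ! j)]))))"
      by (intro diff_order_less_add[OF module_sections module_functions]
          diff_order_less_sum[OF module_sections module_functions]
          diff_order_less_scaleR[OF module_sections module_functions] anchor_term bracket_term) auto
    moreover have "d c (Xs[l := Z]) =
        (\<Sum>i<Suc p. (- 1) ^ i *\<^sub>R act (Xs[l := Z] ! i) (c (omit i (Xs[l := Z])))) +
        (\<Sum>j<Suc p. \<Sum>i<j. (- 1) ^ Suc i *\<^sub>R
          c (omit i ((Xs[l := Z])[j := br (Xs[l := Z] ! i) (Xs[l := Z] ! j)])))" if "Z \<in> S" for Z
      unfolding coboundary_def using set_update_subset[OF Xs that] len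
      by (simp only: if_True length_list_update)
    ultimately show "diff_order_less C S C (k + 2) (\<lambda>Z. d c (Xs[l := Z]))"
      by (subst diff_order_less_cong[OF module_sections]) auto
  qed
qed

lemma lie_diff_ops:
  assumes c: "c \<in> diff_ops M E p" and X: "X \<in> S"
  shows "lie X c \<in> diff_ops M E p"
proof -
  have "d (contraction X c) \<in> diff_ops M E p"
  proof (cases p)
    case 0
    then show ?thesis
      using c contraction_diff_ops_0[of c] coboundary_zero subspace_0[OF subspace_diff_ops] by simp
  next
    case (Suc q)
    then show ?thesis using c contraction_diff_ops[OF _ X] coboundary_diff_ops by blast
  qed
  then show ?thesis
    unfolding lie_eq
    using contraction_diff_ops[OF coboundary_diff_ops[OF c] X] subspace_add[OF subspace_diff_ops] by blast
qed

section \<open>The graded derivations\<close>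

lemma all_diff_ops_multilinear: "c \<in> all_diff_ops M E \<Longrightarrow> c \<in> multilinear_cochains"
  unfolding all_diff_ops_def
  using span_minimal[OF _ subspace_multilinear_cochains] diff_ops_multilinear by blast

lemma all_diff_ops_cochain: "c \<in> all_diff_ops M E \<Longrightarrow> c \<in> cochains"
  using multilinear_is_cochain all_diff_ops_multilinear by blast

lemma degree_sign_diff_ops:
  assumes "c \<in> diff_ops M E p"
  shows "degree_sign c = (- 1 :: real) ^ p *\<^sub>R c"
proof
  fix Xs
  show "degree_sign c Xs = ((- 1 :: real) ^ p *\<^sub>R c) Xs"
    using diff_ops_arity[OF assms, of Xs]
    by (cases "length Xs = p") (simp_all add: degree_sign_def)
qed

text \<open>Linearity reduces stability of the span to homogeneous elements.  It is assumed on cochains since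
  that is where the three operators are shown to be linear.\<close>

lemma graded_derivationI:
  assumes add: "\<And>a b. a \<in> cochains \<Longrightarrow> b \<in> cochains \<Longrightarrow> A (a + b) = A a + A b"
    and scale: "\<And>r a. a \<in> cochains \<Longrightarrow> A (r *\<^sub>R a) = r *\<^sub>R A a"
    and degree: "\<And>p c. c \<in> diff_ops M E p \<Longrightarrow>
      if int p + n \<ge> 0 then A c \<in> diff_ops M E (nat (int p + n)) else A c = 0"
    and leibniz: "\<And>p a b. a \<in> diff_ops M E p \<Longrightarrow> b \<in> cochains \<Longrightarrow>
      A (shuffle_prod a b) =
        shuffle_prod (A a) b + ((- 1 :: real) powi (n * int p)) *\<^sub>R shuffle_prod a (A b)"
  shows "graded_derivation M E n A"
proof -
  have base: "A c \<in> all_diff_ops M E" if "c \<in> diff_ops M E p" for c p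
    using degree[OF that] unfolding all_diff_ops_def
    by (auto intro: span_base span_zero split: if_splits)
  have zero: "A 0 = 0"
    using scale[OF subspace_0[OF subspace_cochains], of 0] by simp
  have closed: "A c \<in> all_diff_ops M E" if "c \<in> all_diff_ops M E" for c
  proof -
    have "c \<in> all_diff_ops M E \<and> A c \<in> all_diff_ops M E"
      using that unfolding all_diff_ops_def
    proof (induction rule: span_induct_alt)
      case base
      then show ?case using zero by (simp only: span_zero simp_thms)
    next
      case (step r a b)
      then obtain p where a: "a \<in> diff_ops M E p" by blast
      then have ac: "a \<in> cochains" and Aa: "A a \<in> all_diff_ops M E"
        using diff_ops_cochain base by blast+
      have bc: "b \<in> cochains" using step all_diff_ops_cochain[unfolded all_diff_ops_def] by blast
      have "A (r *\<^sub>R a + b) = r *\<^sub>R A a + A b"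
        using add[OF subspace_scale[OF subspace_cochains ac] bc] scale[OF ac] by simp
      moreover have "r *\<^sub>R a + b \<in> span (\<Union>p. diff_ops M E p)"
        using step by (intro span_add span_scale) (auto intro: span_base)
      moreover have "r *\<^sub>R A a + A b \<in> span (\<Union>p. diff_ops M E p)"
        using step Aa[unfolded all_diff_ops_def] by (intro span_add span_scale) auto
      ultimately show ?case by (simp only: simp_thms)
    qed
    then show ?thesis ..
  qed
  show ?thesis
    unfolding graded_derivation_def linear_between_def
    by (intro conjI ballI allI closed add scale degree leibniz all_diff_ops_cochain)
qed

lemma powi_minus_one: "(- 1 :: real) powi (1 * int p) = (- 1) ^ p"
  "(- 1 :: real) powi ((- 1) * int p) = (- 1) ^ p"
  by (simp_all add: power_int_minus power_inverse[symmetric])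

lemma graded_derivation_contraction:
  assumes X: "X \<in> S"
  shows "graded_derivation M E (- 1) (contraction X)"
proof (rule graded_derivationI)
  show "if 0 \<le> int p + - 1 then contraction X c \<in> diff_ops M E (nat (int p + - 1))
      else contraction X c = 0" if "c \<in> diff_ops M E p" for p c
    using that contraction_diff_ops[OF _ X] contraction_diff_ops_0 by (cases p) auto
  show "contraction X (shuffle_prod a b) = shuffle_prod (contraction X a) b +
      ((- 1 :: real) powi (- 1 * int p)) *\<^sub>R shuffle_prod a (contraction X b)"
    if "a \<in> diff_ops M E p" for p a b
    unfolding powi_minus_one contraction_shuffle_prod degree_sign_diff_ops[OF that] shuffle_prod_scaleR ..
qed (simp_all only: contraction_simps)

lemma graded_derivation_coboundary: "graded_derivation M E 1 d"
proof (rule graded_derivationI)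
  show "if 0 \<le> int p + 1 then d c \<in> diff_ops M E (nat (int p + 1)) else d c = 0"
    if "c \<in> diff_ops M E p" for p c
    using coboundary_diff_ops[OF that] by (simp add: nat_add_distrib)
  show "d (shuffle_prod a b) = shuffle_prod (d a) b +
      ((- 1 :: real) powi (1 * int p)) *\<^sub>R shuffle_prod a (d b)"
    if "a \<in> diff_ops M E p" "b \<in> cochains" for p a b
    unfolding powi_minus_one coboundary_shuffle_prod[OF diff_ops_cochain[OF that(1)] that(2)]
      degree_sign_diff_ops[OF that(1)] shuffle_prod_scaleR ..
qed (simp_all only: coboundary_add coboundary_scaleR)

lemma graded_derivation_lie:
  assumes X: "X \<in> S"
  shows "graded_derivation M E 0 (lie X)"
proof (rule graded_derivationI)
  show "if 0 \<le> int p + 0 then lie X c \<in> diff_ops M E (nat (int p + 0)) else lie X c = 0"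
    if "c \<in> diff_ops M E p" for p c
    using lie_diff_ops[OF that X] by simp
  show "lie X (shuffle_prod a b) = shuffle_prod (lie X a) b +
      ((- 1 :: real) powi (0 * int p)) *\<^sub>R shuffle_prod a (lie X b)"
    if "a \<in> diff_ops M E p" "b \<in> cochains" for p a b
    using lie_shuffle_prod[OF diff_ops_cochain[OF that(1)] that(2) X] by simp
qed (simp_all only: lie_add lie_scaleR X)

end

theorem theorem4p8p10:
  fixes M :: "('m::{t2_space,second_countable_topology}, 'e::real_inner) manifold"
    and E :: "('m, 'k, 'v::real_vector) vbundle"
    and L :: "('m, 'v) loday_structure"
    and X Y :: "'m \<Rightarrow> 'v"
  assumes "smooth_manifold M"
    and "vector_bundle M E"
    and "loday_algebroid M E L"
    and "X \<in> sections M E"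
    and "Y \<in> sections M E"
  shows
    "graded_derivation M E 1 (coboundary M E L) \<and>
     graded_derivation M E (-1) (contraction X) \<and>
     graded_derivation M E 0 (lie_derivative M E L X) \<and>
     (\<forall>c\<in>all_diff_ops M E.
        2 *\<^sub>R coboundary M E L (coboundary M E L c) =
          supercomm 1 (coboundary M E L) 1 (coboundary M E L) c \<and>
        supercomm 1 (coboundary M E L) 1 (coboundary M E L) c = 0) \<and>
     (\<forall>c\<in>all_diff_ops M E.
        lie_derivative M E L X c = supercomm 1 (coboundary M E L) (-1) (contraction X) c \<and>
        supercomm 1 (coboundary M E L) (-1) (contraction X) c =
          coboundary M E L (contraction X c) + contraction X (coboundary M E L c)) \<and>
     (\<forall>c\<in>all_diff_ops M E.
        coboundary M E L (lie_derivative M E L X c) - lie_derivative M E L X (coboundary M E L c) =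
          supercomm 1 (coboundary M E L) 0 (lie_derivative M E L X) c \<and>
        supercomm 1 (coboundary M E L) 0 (lie_derivative M E L X) c = 0) \<and>
     (\<forall>c\<in>all_diff_ops M E.
        lie_derivative M E L X (contraction Y c) - contraction Y (lie_derivative M E L X c) =
          supercomm 0 (lie_derivative M E L X) (-1) (contraction Y) c \<and>
        supercomm 0 (lie_derivative M E L X) (-1) (contraction Y) c =
          contraction (bracket L X Y) c) \<and>
     (\<forall>c\<in>all_diff_ops M E.
        lie_derivative M E L X (lie_derivative M E L Y c)
            - lie_derivative M E L Y (lie_derivative M E L X c) =
          supercomm 0 (lie_derivative M E L X) 0 (lie_derivative M E L Y) c \<and>
        supercomm 0 (lie_derivative M E L X) 0 (lie_derivative M E L Y) c =
          lie_derivative M E L (bracket L X Y) c)"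
proof -
  interpret loday_algebroid_on_bundle M E L
    using assms(1-3) by unfold_locales
  note X = assms(4) and Y = assms(5)
  have supercomm_0: "supercomm a A b B c = A (B c) - B (A c)" if "a * b = 0"
    for a b and A B :: "('m, 'v) oper \<Rightarrow> ('m, 'v) oper" and c
    by (simp only: supercomm_def that power_int_0_right scaleR_one)
  have a: "2 *\<^sub>R d (d c) = supercomm 1 d 1 d c \<and> supercomm 1 d 1 d c = 0"
    if "c \<in> all_diff_ops M E" for c
    using coboundary_coboundary[OF all_diff_ops_multilinear[OF that]]
    by (simp add: supercomm_def)
  have b: "lie X c = supercomm 1 d (- 1) (contraction X) c \<and>
      supercomm 1 d (- 1) (contraction X) c = d (contraction X c) + contraction X (d c)" for c
    by (simp add: lie_derivative_def supercomm_def)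
  have c: "d (lie X c) - lie X (d c) = supercomm 1 d 0 (lie X) c \<and> supercomm 1 d 0 (lie X) c = 0"
    if "c \<in> all_diff_ops M E" for c
    using coboundary_lie[OF all_diff_ops_multilinear[OF that] X] by (simp add: supercomm_0)
  have d: "lie X (contraction Y c) - contraction Y (lie X c) = supercomm 0 (lie X) (- 1) (contraction Y) c \<and>
      supercomm 0 (lie X) (- 1) (contraction Y) c = contraction (br X Y) c"
    if "c \<in> all_diff_ops M E" for c
    using lie_contraction_commutator[OF all_diff_ops_cochain[OF that] X Y] by (simp add: supercomm_0)
  have e: "lie X (lie Y c) - lie Y (lie X c) = supercomm 0 (lie X) 0 (lie Y) c \<and>
      supercomm 0 (lie X) 0 (lie Y) c = lie (br X Y) c"
    if "c \<in> all_diff_ops M E" for c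
    using lie_commutator[OF all_diff_ops_multilinear[OF that] X Y] by (simp add: supercomm_0)
  show ?thesis
    using graded_derivation_coboundary graded_derivation_contraction[OF X] graded_derivation_lie[OF X]
      a b c d e by blast
qed

end
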